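(* Suppose $G$ is a subgroup of $\mathrm{Homeo}_+(S^1)$ such that the elements of $G$ are either 1. all piecewise-linear, each admitting at most finitely many breakpoints, or 2. all $C^1$ with bounded variation in the first derivative, and suppose there is $g\in G$ with $\mathrm{Rot}(g)\notin\mathbb Q/\mathbb Z$. Then $G$ is topologically conjugate to a group of rotations (and is thus abelian), or $G$ contains a non-abelian free subgroup.
   Context: $\mathrm{Homeo}_+(S^1)$ is the group of orientation-preserving homeomorphisms of the circle $S^1=\mathbb R/\mathbb Z$. The rotation number of $f\in\mathrm{Homeo}_+(S^1)$ is $\mathrm{Rot}(f)=\lim_{n\to\infty}F^n(t)/n\pmod 1\in\mathbb R/\mathbb Z$, where $F:\mathbb R\to\mathbb R$ is any lift of $f$ and $t\in\mathbb R$ is any point (independent of choices). "Topologically conjugate to a group of rotations" means that there is a $z\in\mathrm{Homeo}_+(S^1)$ such that conjugation by $z$ takes every element of $G$ to a rotation $x\mapsto x+\alpha$ of $\mathbb R/\mathbb Z$. *)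

theory Defs
  imports "HOL-Analysis.Analysis" "HOL-Algebra.Generated_Groups"
begin

section \<open>The circle \<open>\<real>/\<int>\<close>\<close>

quotient_type circle = real / "\<lambda>x y :: real. x - y \<in> \<int>"
  morphisms rep_circle to_circle
proof (rule equivpI)
  show "reflp (\<lambda>x y :: real. x - y \<in> \<int>)"
    by (simp add: reflp_def)
  show "symp (\<lambda>x y :: real. x - y \<in> \<int>)"
    by (metis (mono_tags, lifting) Ints_minus minus_diff_eq sympI)
  show "transp (\<lambda>x y :: real. x - y \<in> \<int>)"
  proof (rule transpI)
    fix x y z :: real
    assume "x - y \<in> \<int>" "y - z \<in> \<int>"
    then have "(x - y) + (y - z) \<in> \<int>" by (rule Ints_add)
    then show "x - z \<in> \<int>" by simp
  qed
qed

lemma to_circle_eq_iff: "to_circle x = to_circle y \<longleftrightarrow> x - y \<in> \<int>"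
  by (simp add: circle.abs_eq_iff)

lemma to_circle_surj: "\<exists>x. c = to_circle x"
  by (induct c rule: circle.abs_induct) blast

instantiation circle :: ab_group_add
begin

lift_definition zero_circle :: circle is "0 :: real" .

lift_definition plus_circle :: "circle \<Rightarrow> circle \<Rightarrow> circle" is "(+) :: real \<Rightarrow> real \<Rightarrow> real"
  by (metis Ints_add add_diff_add)

lift_definition uminus_circle :: "circle \<Rightarrow> circle" is "uminus :: real \<Rightarrow> real"
  by (metis Ints_minus minus_diff_minus)

lift_definition minus_circle :: "circle \<Rightarrow> circle \<Rightarrow> circle" is "(-) :: real \<Rightarrow> real \<Rightarrow> real"
proof -
  fix a b c d :: real
  assume "a - b \<in> \<int>" "c - d \<in> \<int>"
  then have "(a - b) - (c - d) \<in> \<int>" by (rule Ints_diff)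
  then show "(a - c) - (b - d) \<in> \<int>" by (simp add: algebra_simps)
qed

instance
  by standard (transfer; simp add: algebra_simps)+

end

text \<open>The topology is the quotient topology.\<close>

instantiation circle :: topological_space
begin

definition open_circle :: "circle set \<Rightarrow> bool" where
  "open_circle U \<longleftrightarrow> open (to_circle -` U)"

instance
  by standard (auto simp: open_circle_def vimage_Union)

end

section \<open>Orientation-preserving homeomorphisms\<close>

definition is_lift :: "(circle \<Rightarrow> circle) \<Rightarrow> (real \<Rightarrow> real) \<Rightarrow> bool" where
  "is_lift f F \<longleftrightarrow> continuous_on UNIV F \<and> (\<forall>x. to_circle (F x) = f (to_circle x))"

definition orientation_preserving :: "(circle \<Rightarrow> circle) \<Rightarrow> bool" where
  "orientation_preserving f \<longleftrightarrow> (\<exists>F. is_lift f F \<and> strict_mono F)"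

definition Homeo_plus :: "(circle \<Rightarrow> circle) monoid" where
  "Homeo_plus =
     \<lparr>carrier = {f. (\<exists>g. homeomorphism UNIV UNIV f g) \<and> orientation_preserving f},
      mult = (\<circ>), one = id\<rparr>"

definition Rot :: "(circle \<Rightarrow> circle) \<Rightarrow> circle" where
  "Rot f = (THE r. \<forall>F t. is_lift f F \<longrightarrow>
     (\<exists>L. (\<lambda>n. (F ^^ n) t / real n) \<longlonglongrightarrow> L \<and> r = to_circle L))"

text \<open>The subgroup \<open>\<rat>/\<int>\<close> of the circle.\<close>

definition rational_circle :: "circle set" where
  "rational_circle = to_circle ` \<rat>"

text \<open>The conjugator \<open>z\<close> is bijective, so \<open>inv_into UNIV z\<close> is its inverse.\<close>

definition conjugate_to_rotations :: "(circle \<Rightarrow> circle) set \<Rightarrow> bool" where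
  "conjugate_to_rotations G \<longleftrightarrow>
     (\<exists>z \<in> carrier Homeo_plus. \<forall>g \<in> G. \<exists>\<alpha>. z \<circ> g \<circ> inv_into UNIV z = (\<lambda>x. x + \<alpha>))"

section \<open>Regularity\<close>

text \<open>
  Breakpoints are the points near which no lift is affine. Two lifts of the same map differ by
  an integer, so it does not matter which one is tested.
\<close>

definition breakpoints :: "(circle \<Rightarrow> circle) \<Rightarrow> circle set" where
  "breakpoints f = to_circle ` {x. \<not> (\<exists>F. is_lift f F \<and>
     (\<exists>a b. eventually (\<lambda>y. F y = a * y + b) (nhds x)))}"

definition piecewise_linear :: "(circle \<Rightarrow> circle) \<Rightarrow> bool" where
  "piecewise_linear f \<longleftrightarrow> finite (breakpoints f)"

definition bounded_variation_on :: "(real \<Rightarrow> real) \<Rightarrow> real \<Rightarrow> real \<Rightarrow> bool" where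
  "bounded_variation_on h a b \<longleftrightarrow>
     (\<exists>M. \<forall>(n::nat) t. t ` {..n} \<subseteq> {a..b} \<and> mono_on {..n} t \<longrightarrow>
        (\<Sum>i<n. \<bar>h (t (Suc i)) - h (t i)\<bar>) \<le> M)"

text \<open>
  The derivative of a lift has period 1, so its variation over \<open>[0,1]\<close> is its variation
  over the circle.
\<close>

definition C1_bounded_variation :: "(circle \<Rightarrow> circle) \<Rightarrow> bool" where
  "C1_bounded_variation f \<longleftrightarrow>
     (\<exists>F F'. is_lift f F \<and> (\<forall>x. (F has_real_derivative F' x) (at x)) \<and>
        continuous_on UNIV F' \<and> bounded_variation_on F' 0 1)"

section \<open>Free groups\<close>

text \<open>The letter \<open>(x, True)\<close> stands for \<open>x\<close> and \<open>(x, False)\<close> for its inverse.\<close>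

definition word_value :: "('a, 'm) monoid_scheme \<Rightarrow> ('a \<times> bool) list \<Rightarrow> 'a" where
  "word_value H w =
     foldr (\<lambda>(x, e) y. (if e then x else inv\<^bsub>H\<^esub> x) \<otimes>\<^bsub>H\<^esub> y) w \<one>\<^bsub>H\<^esub>"

definition reduced_word :: "('a \<times> bool) list \<Rightarrow> bool" where
  "reduced_word w \<longleftrightarrow> successively (\<lambda>(x, e) (y, d). \<not> (x = y \<and> e \<noteq> d)) w"

definition free_basis :: "('a, 'm) monoid_scheme \<Rightarrow> 'a set \<Rightarrow> bool" where
  "free_basis H S \<longleftrightarrow> S \<subseteq> carrier H \<and> generate H S = carrier H \<and>
     (\<forall>w. w \<noteq> [] \<and> set w \<subseteq> S \<times> UNIV \<and> reduced_word w \<longrightarrow> word_value H w \<noteq> \<one>\<^bsub>H\<^esub>)"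

definition free_group :: "('a, 'm) monoid_scheme \<Rightarrow> bool" where
  "free_group H \<longleftrightarrow> group H \<and> (\<exists>S. free_basis H S)"

section \<open>\<open>Homeo_plus\<close> is a group\<close>

lemma is_lift_compose:
  assumes "is_lift f F" "is_lift g G"
  shows "is_lift (f \<circ> g) (F \<circ> G)"
  using assms unfolding is_lift_def
  by (metis comp_apply continuous_on_compose continuous_on_subset subset_UNIV)

lemma is_lift_shift:
  assumes "is_lift f F"
  obtains k :: int where "\<And>x. F (x + 1) = F x + of_int k"
proof -
  have F: "continuous_on UNIV F" and l: "\<And>x. to_circle (F x) = f (to_circle x)"
    using assms by (auto simp: is_lift_def)
  have ints: "F (x + 1) - F x \<in> \<int>" for x
  proof -
    have "to_circle (x + 1) = to_circle x" by (simp add: to_circle_eq_iff)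
    then show ?thesis using l by (metis to_circle_eq_iff)
  qed
  have "continuous_on UNIV (\<lambda>x. F (x + 1))"
    by (rule continuous_on_compose2[OF F]) (auto intro!: continuous_intros)
  with F have c: "continuous_on UNIV (\<lambda>x. F (x + 1) - F x)"
    by (intro continuous_intros)
  have "(\<lambda>x. F (x + 1) - F x) constant_on UNIV"
  proof (rule continuous_discrete_range_constant[OF connected_UNIV c])
    fix x :: real
    show "\<exists>e>0. \<forall>y. y \<in> UNIV \<and> F (y + 1) - F y \<noteq> F (x + 1) - F x \<longrightarrow>
       e \<le> norm (F (y + 1) - F y - (F (x + 1) - F x))"
    proof (intro exI[of _ 1] conjI allI impI)
      fix y assume "y \<in> UNIV \<and> F (y + 1) - F y \<noteq> F (x + 1) - F x"
      then show "1 \<le> norm (F (y + 1) - F y - (F (x + 1) - F x))"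
        using ints[of x] ints[of y] by (metis Ints_diff Ints_nonzero_abs_ge1 real_norm_def right_minus_eq)
    qed simp
  qed
  then obtain d where d: "\<And>x. F (x + 1) - F x = d"
    by (auto simp: constant_on_def)
  then obtain k :: int where "d = of_int k" using ints by (metis Ints_cases)
  with d have "F (x + 1) = F x + of_int k" for x
    by (metis add.commute diff_add_cancel)
  then show ?thesis by (rule that)
qed

lemma strict_mono_lift_surj:
  assumes "is_lift f F" "strict_mono F"
  shows "surj F"
proof -
  obtain k :: int where k: "\<And>x. F (x + 1) = F x + of_int k"
    using is_lift_shift[OF assms(1)] by metis
  have "F 0 < F (0 + 1)" using assms(2) by (simp add: strict_mono_def)
  then have "0 < k" by (simp only: k less_add_same_cancel1 of_int_0_less_iff)
  then have k1: "1 \<le> real_of_int k" by linarith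
  have up: "F (real n) = F 0 + real n * real_of_int k" for n
  proof (induction n)
    case (Suc n)
    then show ?case using k[of "real n"] by (simp add: algebra_simps)
  qed simp
  have down: "F (- real n) = F 0 - real n * real_of_int k" for n
  proof (induction n)
    case (Suc n)
    have "F (- real n) = F (- real (Suc n) + 1)" by (rule arg_cong[of _ _ F]) simp
    then show ?case using Suc k[of "- real (Suc n)"] by (simp add: algebra_simps)
  qed simp
  have "\<exists>x. F x = y" for y
  proof -
    obtain n :: nat where n: "\<bar>y - F 0\<bar> \<le> real n" using real_arch_simple by blast
    have "real n \<le> real n * real_of_int k" using k1 by (simp add: mult_le_cancel_left1)
    then have "F (- real n) \<le> y" "y \<le> F (real n)" using up[of n] down[of n] n by linarith+
    moreover have "continuous_on {- real n..real n} F"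
      using assms(1) continuous_on_subset unfolding is_lift_def by blast
    ultimately show ?thesis using IVT'[of F "- real n" y "real n"] by auto
  qed
  then show ?thesis by (metis surjI)
qed

lemma orientation_preserving_inverse:
  assumes "homeomorphism UNIV UNIV f g" "orientation_preserving f"
  shows "orientation_preserving g"
proof -
  obtain F where F: "is_lift f F" "strict_mono F"
    using assms(2) by (auto simp: orientation_preserving_def)
  define H where "H = inv_into UNIV F"
  have FH: "F (H y) = y" for y
    using strict_mono_lift_surj[OF F] by (simp add: H_def surj_f_inv_f)
  have mono: "strict_mono H"
    by (rule strict_monoI) (metis F(2) FH strict_mono_less)
  have "H (F x) = x" for x
    using F(2) FH by (metis strict_mono_eq)
  then have "surj H" by (metis surjI)
  then have "continuous_on UNIV H"
    using mono continuous_onI_mono[of H UNIV] by (simp add: strict_mono_less_eq)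
  moreover have "to_circle (H y) = g (to_circle y)" for y
    using F(1) assms(1) FH[of y] unfolding is_lift_def homeomorphism_def by (metis UNIV_I)
  ultimately show ?thesis
    using mono unfolding orientation_preserving_def is_lift_def by blast
qed

lemma group_Homeo_plus: "group Homeo_plus"
proof (rule groupI)
  show "\<one>\<^bsub>Homeo_plus\<^esub> \<in> carrier Homeo_plus"
    unfolding Homeo_plus_def orientation_preserving_def is_lift_def
    by (auto intro!: exI[of _ id] homeomorphismI simp: strict_mono_def)
next
  fix f g
  assume f: "f \<in> carrier Homeo_plus" and g: "g \<in> carrier Homeo_plus"
  obtain F G where "is_lift f F" "strict_mono F" "is_lift g G" "strict_mono G"
    using f g by (auto simp: Homeo_plus_def orientation_preserving_def)
  then have "is_lift (f \<circ> g) (F \<circ> G)" "strict_mono (F \<circ> G)"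
    by (auto simp: is_lift_compose strict_mono_def)
  moreover have "\<exists>h. homeomorphism UNIV UNIV (f \<circ> g) h"
    using f g homeomorphism_compose by (fastforce simp: Homeo_plus_def)
  ultimately show "f \<otimes>\<^bsub>Homeo_plus\<^esub> g \<in> carrier Homeo_plus"
    by (auto simp: Homeo_plus_def orientation_preserving_def)
next
  fix f
  assume f: "f \<in> carrier Homeo_plus"
  then obtain g where g: "homeomorphism UNIV UNIV f g" by (auto simp: Homeo_plus_def)
  then have "g \<in> carrier Homeo_plus"
    using f orientation_preserving_inverse homeomorphism_sym by (fastforce simp: Homeo_plus_def)
  moreover have "g \<circ> f = id" using g by (auto simp: homeomorphism_def)
  ultimately show "\<exists>g \<in> carrier Homeo_plus. g \<otimes>\<^bsub>Homeo_plus\<^esub> f = \<one>\<^bsub>Homeo_plus\<^esub>"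
    by (auto simp: Homeo_plus_def)
qed (auto simp: Homeo_plus_def comp_assoc)

end

theory Submission
  imports Defs
begin

text \<open>
  Let \<open>g \<in> G\<close> have irrational rotation number. Both regularity classes bound the distortion of \<open>g\<close>,
  so Denjoy's argument applies: a wandering interval would have to satisfy
  \<open>|g\<^sup>q I| |g\<^sup>-\<^sup>q I| \<ge> e\<^sup>-\<^sup>C |I|\<^sup>2\<close> at the closest return times \<open>q\<close>, although \<open>|g\<^sup>q I|\<close> tends to \<open>0\<close>.
  Hence \<open>g\<close> is conjugate to an irrational rotation, and after conjugating all of \<open>G\<close> the
  rotations in \<open>G\<close> are dense.

  If some \<open>h \<in> G\<close> is then not a rotation, let \<open>p\<close> be the minimal period of \<open>H(x) - x\<close> for a lift \<open>H\<close> of \<open>h\<close>.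
  For \<open>0 < s < p\<close> some interval of length \<open>s\<close> is shortened by \<open>H\<close>, and since rotations can move
  any interval close to that one, compositions shrink intervals of length \<open>s\<close> to arbitrarily
  small ones. On \<open>\<real>/p\<int>\<close> this gives maps sending the complement of one short arc into
  another, with both arcs placed freely by rotations, and two such maps play ping-pong.
\<close>

section \<open>Lifts\<close>

text \<open>Conjugating \<open>g\<close> to a rotation uses up the regularity: the conjugacy is only
  continuous, so nothing remains known about derivatives of the other elements of \<open>G\<close>.
  The contraction argument therefore works with lengths of images of intervals. Its obstacle is
  symmetry: if \<open>H\<close> commutes with the translation by \<open>p < 1\<close>, so does every
  composition of \<open>H\<close> with rotations, and no interval of length \<open>p\<close> can
  shrink. This forces the passage to \<open>\<real>/p\<int>\<close>, which the circle covers
  finitely often because \<open>p\<close> divides 1. In the Denjoy step the product bound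
  contradicts \<open>|g^q I| -> 0\<close> because \<open>|g^-q I| \<le> 1\<close>. The bound
  compares the distortion along the orbits of \<open>g^-q I\<close> and \<open>I\<close>: at a
  closest return time the hulls of the \<open>i\<close>-th images of the two, for
  \<open>i < q\<close>, are disjoint on the circle, so the differences add up to at most one total
  variation \<open>C\<close>.\<close>

definition lift_map :: "(real \<Rightarrow> real) \<Rightarrow> bool" where
  "lift_map F \<longleftrightarrow> strict_mono F \<and> continuous_on UNIV F \<and> (\<forall>x. F (x + 1) = F x + 1)"

text \<open>The two parameters let one fact serve maps commuting with a translation
  (\<open>q = p\<close>), periodic functions (\<open>q = 0\<close>) and functions that grow by a
  constant \<open>C\<close> per period.\<close>

lemma commutes_translation_int:
  fixes F :: "real \<Rightarrow> real"
  assumes "\<And>x. F (x + p) = F x + q"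
  shows "F (x + of_int k * p) = F x + of_int k * q"
proof -
  have up: "F (x + real n * p) = F x + real n * q" for n x
  proof (induction n)
    case (Suc n)
    then show ?case using assms[of "x + real n * p"] by (simp add: algebra_simps)
  qed simp
  show ?thesis
  proof (cases k rule: int_cases2)
    case (nonneg n)
    then show ?thesis using up by simp
  next
    case (nonpos n)
    then show ?thesis using up[of "x - real n * p" n] by simp
  qed
qed

lemma lift_map_add_int:
  assumes "lift_map F"
  shows "F (x + of_int k) = F x + of_int k"
  using assms commutes_translation_int[of F 1 1] by (simp add: lift_map_def)

lemma lift_map_translation: "lift_map (\<lambda>x. x + c)"
  by (auto simp: lift_map_def strict_mono_def intro!: continuous_intros)

lemma lift_map_comp: "lift_map F \<Longrightarrow> lift_map H \<Longrightarrow> lift_map (\<lambda>x. F (H x))"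
  by (auto simp: lift_map_def strict_mono_def intro: continuous_on_compose2[of UNIV F])

lemma lift_map_funpow: "lift_map F \<Longrightarrow> lift_map (F ^^ n)"
proof (induction n)
  case 0
  then show ?case using lift_map_translation[of 0] by (simp add: id_def)
next
  case (Suc n)
  then show ?case using lift_map_comp[of F "F ^^ n"] by (simp add: comp_def)
qed

lemma lift_map_surj:
  assumes F: "lift_map F"
  shows "surj F"
proof -
  have "\<exists>x. F x = y" for y
  proof -
    define k where "k = \<lfloor>y - F 0\<rfloor>"
    have "F (of_int k) \<le> y" "y \<le> F (of_int k + 1)"
      using lift_map_add_int[OF F, of 0 k] F unfolding k_def lift_map_def by (simp; linarith)+
    then show ?thesis
      using IVT'[of F "of_int k" y "of_int k + 1"] F continuous_on_subset
      unfolding lift_map_def by (metis le_add_same_cancel1 subset_UNIV zero_le_one)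
  qed
  then show ?thesis by (metis surjI)
qed

lemma lift_map_bij: "lift_map F \<Longrightarrow> bij F"
  using lift_map_surj strict_mono_imp_inj_on unfolding bij_def lift_map_def by blast

lemma lift_map_inv_cancel:
  assumes "lift_map F"
  shows "F (inv_into UNIV F x) = x" "inv_into UNIV F (F x) = x"
  using lift_map_bij[OF assms] by (simp_all add: bij_is_surj surj_f_inv_f bij_is_inj)

lemma lift_map_inv:
  assumes F: "lift_map F"
  shows "lift_map (inv_into UNIV F)"
proof -
  note [simp] = lift_map_inv_cancel[OF F]
  have sm: "strict_mono (inv_into UNIV F)"
    by (rule strict_monoI)
       (metis F lift_map_def lift_map_inv_cancel(1) strict_mono_less)
  have "surj (inv_into UNIV F)" by (metis lift_map_inv_cancel(2)[OF F] surjI)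
  then have "continuous_on UNIV (inv_into UNIV F)"
    using sm continuous_onI_mono[of "inv_into UNIV F" UNIV] by (simp add: strict_mono_less_eq)
  moreover have "inv_into UNIV F (x + 1) = inv_into UNIV F x + 1" for x
    using F unfolding lift_map_def by (metis lift_map_inv_cancel[OF F])
  ultimately show ?thesis using sm by (simp add: lift_map_def)
qed

lemma lift_map_less_iff: "lift_map F \<Longrightarrow> F x < F y \<longleftrightarrow> x < y"
  by (simp add: lift_map_def strict_mono_less)

lemma lift_map_le_iff: "lift_map F \<Longrightarrow> F x \<le> F y \<longleftrightarrow> x \<le> y"
  by (simp add: lift_map_def strict_mono_less_eq)

section \<open>Displacements and the translation number\<close>

lemma lift_map_displacement:
  assumes F: "lift_map F"
  shows "\<bar>(F x - x) - (F y - y)\<bar> \<le> 1"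
proof -
  define k where "k = \<lfloor>x - y\<rfloor>"
  have k: "y + of_int k \<le> x" "x \<le> y + of_int (k + 1)" unfolding k_def by linarith+
  then have "F (y + of_int k) \<le> F x" "F x \<le> F (y + of_int (k + 1))"
    using lift_map_le_iff[OF F] by blast+
  then show ?thesis
    using k lift_map_add_int[OF F, of y k] lift_map_add_int[OF F, of y "k+1"] by simp
qed

text \<open>With \<open>m n\<close> the integer part of \<open>(F ^^ n) 0\<close>, the intervals
  from \<open>m n / n\<close> to \<open>(m n + 1) / n\<close> meet pairwise, so the supremum
  \<open>\<alpha>\<close> of their left ends lies in all of them. The constant 2 is 1 for rounding
  the orbit of 0 plus 1 for passing from 0 to \<open>x\<close>.\<close>

lemma lift_map_translation_number:
  assumes F: "lift_map F"
  obtains \<alpha> where "\<And>n x. \<bar>(F ^^ n) x - x - real n * \<alpha>\<bar> \<le> 2"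
proof -
  define m where "m n = \<lfloor>(F ^^ n) 0\<rfloor>" for n
  have bounds: "real k * of_int (m n) \<le> (F ^^ (k * n)) 0 \<and> (F ^^ (k * n)) 0 \<le> real k * (of_int (m n) + 1)" for k n
  proof (induction k)
    case (Suc k)
    have L: "lift_map (F ^^ (k * n))" by (rule lift_map_funpow[OF F])
    have "(F ^^ (Suc k * n)) 0 = (F ^^ (k * n)) ((F ^^ n) 0)"
      by (simp add: add.commute[of n] funpow_add)
    moreover have "(F ^^ (k * n)) (of_int (m n)) \<le> (F ^^ (k * n)) ((F ^^ n) 0)"
      "(F ^^ (k * n)) ((F ^^ n) 0) \<le> (F ^^ (k * n)) (of_int (m n + 1))"
      unfolding lift_map_le_iff[OF L] m_def by linarith+
    ultimately show ?case
      using Suc lift_map_add_int[OF L, of 0 "m n"] lift_map_add_int[OF L, of 0 "m n + 1"]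
      by (simp add: algebra_simps)
  qed simp
  define S where "S = (\<lambda>n. of_int (m n) / real n) ` {1..}"
  \<comment> \<open>Both fractions are compared through \<open>(F ^^ (k * n)) 0\<close>, read once
    as a power of \<open>F ^^ n\<close> and once as a power of \<open>F ^^ k\<close>.\<close>
  have cross: "of_int (m n) / real n \<le> (of_int (m k) + 1) / real k" if "n \<ge> 1" "k \<ge> 1" for n k
  proof -
    have "real k * of_int (m n) \<le> real n * (of_int (m k) + 1)"
      using bounds[of k n] bounds[of n k] by (simp add: mult.commute)
    then show ?thesis using that by (simp add: field_simps)
  qed
  define \<alpha> where "\<alpha> = Sup S"
  have "bdd_above S" unfolding S_def bdd_above_def using cross by fastforce
  then have lo: "of_int (m n) / real n \<le> \<alpha>" if "n \<ge> 1" for n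
    unfolding \<alpha>_def by (rule cSup_upper[rotated]) (use that in \<open>auto simp: S_def\<close>)
  have hi: "\<alpha> \<le> (of_int (m n) + 1) / real n" if "n \<ge> 1" for n
    unfolding \<alpha>_def by (rule cSup_least) (use that cross in \<open>auto simp: S_def\<close>)
  have "\<bar>(F ^^ n) x - x - real n * \<alpha>\<bar> \<le> 2" for n x
  proof (cases "n = 0")
    case False
    then have "of_int (m n) \<le> real n * \<alpha>" "real n * \<alpha> \<le> of_int (m n) + 1"
      using lo[of n] hi[of n] by (simp_all add: field_simps)
    moreover have "of_int (m n) \<le> (F ^^ n) 0" "(F ^^ n) 0 \<le> of_int (m n) + 1"
      unfolding m_def by linarith+
    ultimately show ?thesis
      using lift_map_displacement[OF lift_map_funpow[OF F, of n], of x 0] by linarith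
  qed simp
  then show ?thesis by (rule that)
qed

section \<open>Multiples of an irrational number modulo the integers\<close>

lemma dense_multiples_mod_int:
  fixes \<alpha> :: real
  assumes "\<alpha> \<notin> \<rat>" "a < b"
  obtains n :: nat and m :: int where "a < real n * \<alpha> + of_int m" "real n * \<alpha> + of_int m < b"
proof -
  define c where "c = (a + b) / 2"
  obtain k where k: "\<bar>frac (real k * \<alpha>) - frac c\<bar> < (b - a) / 2"
    using Kronecker_approx_1_explicit[OF assms(1), of "frac c" "(b - a) / 2"] assms(2)
    by (metis diff_gt_0_iff_gt frac_ge_0 frac_lt_1 half_gt_zero less_imp_le)
  have "\<bar>real k * \<alpha> + of_int (\<lfloor>c\<rfloor> - \<lfloor>real k * \<alpha>\<rfloor>) - c\<bar> < (b - a) / 2"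
    using k by (simp add: frac_def algebra_simps)
  then show ?thesis
    by (intro that[of k "\<lfloor>c\<rfloor> - \<lfloor>real k * \<alpha>\<rfloor>"]) (auto simp: c_def abs_if field_simps split: if_splits)
qed

text \<open>A substitute for the convergents of a continued fraction: \<open>q\<close> is the least
  positive integer with \<open>q \<alpha>\<close> closer to an integer than
  \<open>\<epsilon>\<close>, the best distance reached by \<open>1, ..., N + 1\<close>. This forces
  \<open>q > N\<close>, and every smaller multiple stays at distance at least
  \<open>\<epsilon>\<close>.\<close>

lemma closest_return:
  fixes \<alpha> :: real
  assumes "\<alpha> \<notin> \<rat>"
  obtains q p where "q > N" "\<And>k m. 0 < k \<Longrightarrow> k < q \<Longrightarrow> \<bar>real q * \<alpha> - of_int p\<bar> < \<bar>real k * \<alpha> - of_int m\<bar>"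
proof -
  define e where "e k = \<bar>real k * \<alpha> - of_int (round (real k * \<alpha>))\<bar>" for k
  have e_le: "e k \<le> \<bar>real k * \<alpha> - of_int m\<bar>" for k m
    unfolding e_def using round_diff_minimal[of "real k * \<alpha>" m] by (simp add: abs_minus_commute)
  have e_pos: "e k > 0" if "k > 0" for k
  proof -
    have "real k * \<alpha> \<noteq> of_int j" for j
    proof
      assume "real k * \<alpha> = of_int j"
      then have "\<alpha> = of_int j / of_nat k" using that by (simp add: field_simps)
      then show False using assms by simp
    qed
    then show ?thesis by (simp add: e_def)
  qed
  define \<epsilon> where "\<epsilon> = Min (e ` {1..Suc N})"
  have \<epsilon>: "\<epsilon> > 0" "\<And>k. 1 \<le> k \<Longrightarrow> k \<le> Suc N \<Longrightarrow> \<epsilon> \<le> e k"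
    unfolding \<epsilon>_def using e_pos by (auto simp del: atLeastAtMost_iff intro: Min_le) (simp_all add: e_pos)
  define P where "P k \<longleftrightarrow> k > 0 \<and> (\<exists>h::int. \<bar>real k * \<alpha> - of_int h\<bar> < \<epsilon>)" for k
  obtain M :: nat where "1 / M < \<epsilon>" "M > 0"
    by (metis \<epsilon>(1) gr_zeroI inverse_eq_divide real_arch_inverse)
  then obtain h k where "0 < k" "\<bar>of_int k * \<alpha> - of_int h\<bar> < \<epsilon>"
    using Dirichlet_approx[of M \<alpha>] by (metis order_less_trans)
  then have "P (nat k)" by (auto simp: P_def)
  define q where "q = (LEAST k. P k)"
  have "P q" unfolding q_def by (rule LeastI) fact
  then obtain p :: int where p: "q > 0" "\<bar>real q * \<alpha> - of_int p\<bar> < \<epsilon>" by (auto simp: P_def)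
  have notP: "\<not> P k" if "k < q" for k using that not_less_Least q_def by blast
  have "q > N"
    using \<epsilon>(2)[of q] e_le[of q p] p by linarith
  moreover have "\<bar>real q * \<alpha> - of_int p\<bar> < \<bar>real k * \<alpha> - of_int m\<bar>" if "0 < k" "k < q" for k m
    using notP[OF that(2)] that(1) p(2) by (auto simp: P_def not_less intro: less_le_trans)
  ultimately show ?thesis by (rule that)
qed

section \<open>Denjoy's theorem\<close>

text \<open>Induction that removes the interval with the greatest left end: disjointness puts all
  others to the left of that end, where the bound on \<open>V\<close> is split.\<close>

lemma sum_increments_disjoint:
  fixes V :: "real \<Rightarrow> real" and a b :: "'i \<Rightarrow> real"
  assumes "mono V" "finite S" "u \<le> c"
    and "\<And>i. i \<in> S \<Longrightarrow> u \<le> a i \<and> a i < b i \<and> b i \<le> c"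
    and "\<And>i j. i \<in> S \<Longrightarrow> j \<in> S \<Longrightarrow> i \<noteq> j \<Longrightarrow> b i \<le> a j \<or> b j \<le> a i"
  shows "(\<Sum>i\<in>S. V (b i) - V (a i)) \<le> V c - V u"
  using assms(2-)
proof (induction "card S" arbitrary: S c)
  case 0
  then show ?case using \<open>mono V\<close> by (simp add: monoD)
next
  case (Suc n)
  then have ne: "S \<noteq> {}" by auto
  define A where "A = Max (a ` S)"
  have "A \<in> a ` S" unfolding A_def using Suc.prems ne by (intro Max_in) auto
  then obtain i where i: "i \<in> S" "a i = A" by auto
  have max: "a j \<le> a i" if "j \<in> S" for j
    using that Suc.prems(1) i by (simp add: A_def)
  have "(\<Sum>j\<in>S - {i}. V (b j) - V (a j)) \<le> V (a i) - V u"
  proof (rule Suc.hyps)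
    show "b j \<le> a k \<or> b k \<le> a j" if "j \<in> S - {i}" "k \<in> S - {i}" "j \<noteq> k" for j k
      using that Suc.prems by blast
    show "u \<le> a j \<and> a j < b j \<and> b j \<le> a i" if "j \<in> S - {i}" for j
      using that Suc.prems(3)[of j] Suc.prems(3)[of i] Suc.prems(4)[of i j] max[of j] i by force
  qed (use Suc.hyps(2) Suc.prems i in auto)
  moreover have "V (b i) \<le> V c" using \<open>mono V\<close> Suc.prems(3)[OF i(1)] by (simp add: monoD)
  ultimately show ?case by (simp add: sum.remove[OF Suc.prems(1) i(1)])
qed

text \<open>The intervals are disjoint on the circle. Moving each left end into \<open>[0,1)\<close>
  and cutting at the least of them, \<open>u\<close>, puts all intervals into
  \<open>[u, u + 1]\<close>, where \<open>V\<close> grows by \<open>C\<close>. Disjointness from the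
  leftmost interval translated by 1 gives the upper end.\<close>

lemma sum_increments_disjoint_mod_int:
  fixes V :: "real \<Rightarrow> real" and a b :: "'i \<Rightarrow> real"
  assumes V: "mono V" "\<And>x. V (x + 1) = V x + C" and "finite S"
    and ab: "\<And>i. i \<in> S \<Longrightarrow> a i < b i \<and> b i \<le> a i + 1"
    and disj: "\<And>i j (m::int). i \<in> S \<Longrightarrow> j \<in> S \<Longrightarrow> i \<noteq> j \<Longrightarrow> b i \<le> a j + of_int m \<or> b j + of_int m \<le> a i"
  shows "(\<Sum>i\<in>S. V (b i) - V (a i)) \<le> C"
proof (cases "S = {}")
  case True
  have "V 0 \<le> V (0 + 1)" using V(1) by (simp add: monoD)
  then show ?thesis using True V(2)[of 0] by simp
next
  case False
  define a' where "a' i = a i - of_int \<lfloor>a i\<rfloor>" for i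
  define b' where "b' i = b i - of_int \<lfloor>a i\<rfloor>" for i
  have Vint: "V (x - of_int k) = V x - of_int k * C" for x k
    using commutes_translation_int[of V 1 C x "-k"] V(2) by simp
  define u where "u = Min (a' ` S)"
  have "u \<in> a' ` S" unfolding u_def using assms False by (intro Min_in) auto
  then obtain i0 where i0: "i0 \<in> S" "a' i0 = u" by auto
  have a'01: "0 \<le> a' i" "a' i < 1" for i unfolding a'_def by linarith+
  have disj': "b' i \<le> a' j + of_int m \<or> b' j + of_int m \<le> a' i" if "i \<in> S" "j \<in> S" "i \<noteq> j" for i j m
    using disj[OF that, of "m + \<lfloor>a i\<rfloor> - \<lfloor>a j\<rfloor>"] by (auto simp: a'_def b'_def algebra_simps)
  have b'1: "a' i < b' i" "b' i \<le> a' i + 1" if "i \<in> S" for i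
    using ab[OF that] by (auto simp: a'_def b'_def)
  have "(\<Sum>i\<in>S. V (b' i) - V (a' i)) \<le> V (u + 1) - V u"
  proof (rule sum_increments_disjoint[OF V(1) \<open>finite S\<close>, where a = a' and b = b'])
    show "u \<le> a' i \<and> a' i < b' i \<and> b' i \<le> u + 1" if "i \<in> S" for i
    proof -
      have "u \<le> a' i" unfolding u_def using that \<open>finite S\<close> by simp
      moreover have "b' i \<le> u + 1"
      proof (cases "i = i0")
        case False
        then show ?thesis
          using disj'[OF that i0(1) False, of 1] b'1[OF i0(1)] i0 a'01[of i] a'01[of i0]
          by auto
      next
        case True
        then show ?thesis using b'1[OF that] i0 by simp
      qed
      ultimately show ?thesis using b'1[OF that] by simp
    qed
    show "b' i \<le> a' j \<or> b' j \<le> a' i" if "i \<in> S" "j \<in> S" "i \<noteq> j" for i j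
      using disj'[OF that, of 0] by simp
  qed simp
  moreover have "V (b' i) - V (a' i) = V (b i) - V (a i)" for i
    by (simp add: a'_def b'_def Vint)
  ultimately show ?thesis using V(2)[of u] by simp
qed

lemma mono_dense_range_imp_continuous:
  fixes z :: "real \<Rightarrow> real"
  assumes "mono z" and dense: "\<And>a b. a < b \<Longrightarrow> \<exists>x. a < z x \<and> z x < b"
  shows "continuous_on UNIV z"
proof (rule continuous_at_imp_continuous_on, intro ballI, unfold continuous_at_eps_delta, intro allI impI)
  fix x \<epsilon> :: real
  assume "\<epsilon> > 0"
  then obtain u v where uv: "z x - \<epsilon> < z u" "z u < z x" "z x < z v" "z v < z x + \<epsilon>"
    using dense[of "z x - \<epsilon>" "z x"] dense[of "z x" "z x + \<epsilon>"] by auto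
  have "u < x" "x < v"
    using uv(2,3) \<open>mono z\<close> by (meson leD leI monoD)+
  show "\<exists>d>0. \<forall>y. dist y x < d \<longrightarrow> dist (z y) (z x) < \<epsilon>"
  proof (intro exI conjI allI impI)
    show "min (x - u) (v - x) > 0" using \<open>u < x\<close> \<open>x < v\<close> by simp
    fix y assume "dist y x < min (x - u) (v - x)"
    then have "u \<le> y" "y \<le> v" by (auto simp: dist_real_def)
    then have "z u \<le> z y" "z y \<le> z v" using \<open>mono z\<close> by (auto dest: monoD)
    then show "dist (z y) (z x) < \<epsilon>" using uv by (simp add: dist_real_def)
  qed
qed

text \<open>\<open>z x\<close> is the upper limit of \<open>(F ^^ n) x - real n * \<alpha>\<close>,
  built as the limit of the decreasing suprema \<open>s N x\<close>; the sequence itself need not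
  converge. Monotonicity and both equations pass from the terms to the suprema, and the index shift
  caused by \<open>F\<close> disappears in the limit.\<close>

lemma Poincare_semiconjugacy:
  assumes F: "lift_map F" and \<alpha>: "\<And>n x. \<bar>(F ^^ n) x - x - real n * \<alpha>\<bar> \<le> c"
  obtains z where "mono z" "\<And>x. z (x + 1) = z x + 1" "\<And>x. z (F x) = z x + \<alpha>"
proof -
  define d where "d n x = (F ^^ n) x - real n * \<alpha>" for n x
  have d_bound: "x - c \<le> d n x" "d n x \<le> x + c" for n x
    using \<alpha>[of n x] by (auto simp: d_def)
  define s where "s N x = (SUP n\<in>{N..}. d n x)" for N x
  have bdd: "bdd_above ((\<lambda>n. d n x) ` {N..})" for N x
    unfolding bdd_above_def using d_bound(2) by (auto intro!: exI[of _ "x + c"])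
  have le_s: "d n x \<le> s N x" if "N \<le> n" for n N x
    unfolding s_def by (rule cSUP_upper[OF _ bdd]) (use that in auto)
  have s_le: "s N x \<le> y" if "\<And>n. N \<le> n \<Longrightarrow> d n x \<le> y" for N x y
    unfolding s_def by (rule cSUP_least) (use that in auto)
  have decr: "decseq (\<lambda>N. s N x)" for x
    by (intro decseq_SucI s_le le_s) simp
  have "\<exists>l. (\<lambda>N. s N x) \<longlonglongrightarrow> l" for x
  proof -
    have "x - c \<le> s N x" for N using d_bound(1)[where n=N and x=x] le_s[of N N x] by linarith
    then show ?thesis using decseq_convergent[OF decr[of x]] by metis
  qed
  then obtain z where z: "\<And>x. (\<lambda>N. s N x) \<longlonglongrightarrow> z x" by metis
  show ?thesis
  proof (rule that)
    show "mono z"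
    proof (rule monoI)
      fix x y :: real
      assume "x \<le> y"
      then have "d n x \<le> d n y" for n
        using lift_map_le_iff[OF lift_map_funpow[OF F]] by (simp add: d_def)
      then have "s N x \<le> s N y" for N by (meson le_s order_trans s_le)
      then show "z x \<le> z y" by (intro LIMSEQ_le[OF z z]) auto
    qed
    show "z (x + 1) = z x + 1" for x
    proof -
      have d: "d n (x + 1) = d n x + 1" for n
        using lift_map_funpow[OF F, of n] by (simp add: d_def lift_map_def)
      have "s N (x + 1) = s N x + 1" for N
      proof (rule antisym)
        show "s N (x + 1) \<le> s N x + 1" by (rule s_le) (simp add: d le_s)
        have "s N x \<le> s N (x + 1) - 1"
          by (rule s_le) (metis d le_s le_diff_eq)
        then show "s N x + 1 \<le> s N (x + 1)" by simp
      qed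
      then have "(\<lambda>N. s N x + 1) \<longlonglongrightarrow> z (x + 1)" using z[of "x + 1"] by simp
      moreover have "(\<lambda>N. s N x + 1) \<longlonglongrightarrow> z x + 1" by (intro tendsto_intros z)
      ultimately show ?thesis by (rule LIMSEQ_unique)
    qed
    show "z (F x) = z x + \<alpha>" for x
    proof -
      have d: "d n (F x) = d (Suc n) x + \<alpha>" for n
        by (simp add: d_def funpow_swap1 algebra_simps)
      have "s N (F x) = s (Suc N) x + \<alpha>" for N
      proof (rule antisym)
        show "s N (F x) \<le> s (Suc N) x + \<alpha>" by (rule s_le) (simp add: d le_s)
        have "s (Suc N) x \<le> s N (F x) - \<alpha>"
        proof (rule s_le)
          fix n assume "Suc N \<le> n"
          then obtain k where "n = Suc k" "N \<le> k" by (cases n) auto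
          then show "d n x \<le> s N (F x) - \<alpha>" using le_s[of N k "F x"] d[of k] by simp
        qed
        then show "s (Suc N) x + \<alpha> \<le> s N (F x)" by simp
      qed
      then have "(\<lambda>N. s (Suc N) x + \<alpha>) \<longlonglongrightarrow> z (F x)" using z[of "F x"] by simp
      moreover have "(\<lambda>N. s (Suc N) x + \<alpha>) \<longlonglongrightarrow> z x + \<alpha>"
        by (intro tendsto_intros LIMSEQ_Suc z)
      ultimately show ?thesis by (rule LIMSEQ_unique)
    qed
  qed
qed

text \<open>
  The hypothesis on \<open>V\<close> bounds the distortion of \<open>F\<close> in a form shared by the two
  regularity classes: it avoids derivatives, and \<open>C\<close> is the variation over one period.
\<close>

lemma Denjoy:
  assumes F: "lift_map F" and irr: "\<alpha> \<notin> \<rat>"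
    and disp: "\<And>n x. \<bar>(F ^^ n) x - x - real n * \<alpha>\<bar> \<le> c"
    and V: "mono V" "\<And>x. V (x + 1) = V x + C"
    and dist: "\<And>a b x y x' y'. \<lbrakk>a \<le> x; x < y; y \<le> b; a \<le> x'; x' < y'; y' \<le> b; b \<le> a + 1\<rbrakk> \<Longrightarrow>
       \<bar>ln ((F y - F x) / (y - x)) - ln ((F y' - F x') / (y' - x'))\<bar> \<le> V b - V a"
  obtains Z where "lift_map Z" "\<And>x. Z (F x) = Z x + \<alpha>"
proof -
  obtain z where z: "mono z" "\<And>x. z (x + 1) = z x + 1" "\<And>x. z (F x) = z x + \<alpha>"
    using Poincare_semiconjugacy[OF F disp] by blast
  have z_int: "z (x + of_int m) = z x + of_int m" for x m
    using commutes_translation_int[of z 1 1] z(2) by simp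
  have z_pow: "z ((F ^^ n) x) = z x + real n * \<alpha>" for n x
    by (induction n) (simp_all add: z(3) algebra_simps)
  have z_le: "z x \<le> z y" if "x \<le> y" for x y using z(1) that by (rule monoD)
  note pow_less = lift_map_less_iff[OF lift_map_funpow[OF F]]
  have no_rel: "real n * \<alpha> \<noteq> real k * \<alpha> + of_int m" if "n \<noteq> k" for n k m
  proof
    assume "real n * \<alpha> = real k * \<alpha> + of_int m"
    then have "\<alpha> = of_int m / (of_nat n - of_nat k)" using that by (simp add: field_simps)
    moreover have "(of_int m / (of_nat n - of_nat k) :: real) \<in> \<rat>" by (intro Rats_divide Rats_diff) auto
    ultimately show False using irr by simp
  qed
  have "strict_mono z"
  proof (rule ccontr)
    assume "\<not> strict_mono z"
    then obtain x y where xy: "x < y" "z x = z y"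
      by (metis antisym_conv2 strict_monoI z_le order_less_imp_le)
    define len where "len n = (F ^^ n) y - (F ^^ n) x" for n
    \<comment> \<open>\<open>z\<close> is constant on each image of \<open>[x, y]\<close>. Two
      images of length at least \<open>\<epsilon>\<close> whose left ends fall into one cell of
      width \<open>\<epsilon>\<close> modulo 1 would meet, and \<open>z\<close> would give a
      relation excluded by \<open>no_rel\<close>. There are only finitely many cells.\<close>
    have fin: "finite {n. \<epsilon> \<le> len n}" if "\<epsilon> > 0" for \<epsilon>
    proof (rule ccontr)
      assume inf: "infinite {n. \<epsilon> \<le> len n}"
      define cell where "cell n = \<lfloor>frac ((F ^^ n) x) / \<epsilon>\<rfloor>" for n
      have "cell ` {n. \<epsilon> \<le> len n} \<subseteq> {0..\<lfloor>1 / \<epsilon>\<rfloor>}"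
        using \<open>\<epsilon> > 0\<close> less_imp_le[OF frac_lt_1]
        by (auto simp: cell_def intro!: floor_mono divide_right_mono)
      then have "\<not> inj_on cell {n. \<epsilon> \<le> len n}"
        using inf by (meson finite_atLeastAtMost_int finite_imageD finite_subset)
      then obtain n k where nk: "\<epsilon> \<le> len n" "\<epsilon> \<le> len k" "n \<noteq> k" "cell n = cell k"
        by (auto simp: inj_on_def)
      have close: "frac ((F ^^ n) x) < frac ((F ^^ k) x) + \<epsilon>" if "cell n = cell k" for n k
      proof -
        have "frac ((F ^^ n) x) / \<epsilon> < frac ((F ^^ k) x) / \<epsilon> + 1"
          using that unfolding cell_def by linarith
        then show ?thesis using \<open>\<epsilon> > 0\<close> by (simp add: field_simps)
      qed
      have False if "\<epsilon> \<le> len n" "n \<noteq> k" "cell n = cell k" "frac ((F ^^ n) x) \<le> frac ((F ^^ k) x)" for n k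
      proof -
        define m where "m = \<lfloor>(F ^^ n) x\<rfloor> - \<lfloor>(F ^^ k) x\<rfloor>"
        have "(F ^^ n) x \<le> (F ^^ k) x + of_int m"
          using that(4) by (simp add: m_def frac_def)
        then have 1: "z ((F ^^ n) x) \<le> z ((F ^^ k) x + of_int m)" by (rule z_le)
        have "(F ^^ k) x + of_int m \<le> (F ^^ n) y"
          using close[OF that(3)[symmetric]] that(1) by (simp add: m_def frac_def len_def)
        then have "z ((F ^^ k) x + of_int m) \<le> z ((F ^^ n) y)" by (rule z_le)
        with 1 have "real n * \<alpha> = real k * \<alpha> + of_int m" using xy by (simp add: z_int z_pow)
        then show False using no_rel that(2) by blast
      qed
      then show False using nk by (metis linear)
    qed
    \<comment> \<open>The lower bound for \<open>len q\<close> that the distortion estimate will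
      produce; it does not depend on \<open>q\<close>, whereas \<open>len n < \<epsilon>\<close> for
      all \<open>n > N\<close>.\<close>
    define \<epsilon> where "\<epsilon> = (y - x)\<^sup>2 * exp (- C)"
    have "\<epsilon> > 0" using xy by (simp add: \<epsilon>_def)
    then obtain N where N: "\<And>n. \<epsilon> \<le> len n \<Longrightarrow> n \<le> N"
      using fin finite_nat_set_iff_bounded_le by (metis mem_Collect_eq)
    obtain q p where q: "q > Suc N"
      and best: "\<And>k m. 0 < k \<Longrightarrow> k < q \<Longrightarrow> \<bar>real q * \<alpha> - of_int p\<bar> < \<bar>real k * \<alpha> - of_int m\<bar>"
      using closest_return[OF irr, of "Suc N"] by metis
    define \<delta> where "\<delta> = \<bar>real q * \<alpha> - of_int p\<bar>"
    have "\<delta> < 1"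
      using best[of 1 "\<lfloor>\<alpha>\<rfloor>"] q unfolding \<delta>_def by (simp, linarith)
    \<comment> \<open>The orbit is started at \<open>g^-q I\<close>, so that
      \<open>I = [x, y]\<close> is reached after \<open>q\<close> steps and \<open>g^q I\<close>
      after \<open>2 q\<close>.\<close>
    define a where "a = inv_into UNIV (F ^^ q) x"
    define b where "b = inv_into UNIV (F ^^ q) y"
    have Fa: "(F ^^ q) a = x" and Fb: "(F ^^ q) b = y"
      unfolding a_def b_def by (simp_all add: lift_map_inv_cancel[OF lift_map_funpow[OF F]])
    then have "a < b" using xy pow_less by metis
    have zab: "z a = z b" using z_pow[of q a] z_pow[of q b] xy Fa Fb by simp
    have "b \<le> a + 1" using z_le[of "a + 1" b] zab z(2)[of a] by linarith
    define L where "L n = (F ^^ n) b - (F ^^ n) a" for n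
    have L_pos: "L n > 0" for n using \<open>a < b\<close> pow_less by (simp add: L_def)
    define s where "s n = ln (L (Suc n) / L n)" for n
    have s_eq: "s n = ln (L (Suc n)) - ln (L n)" for n
      using L_pos[of n] L_pos[of "Suc n"] by (simp add: s_def ln_div)
    \<comment> \<open>Since \<open>q \<alpha>\<close> is close to \<open>p\<close>, image number
      \<open>i\<close>, shifted by \<open>p\<close>, is close to image number \<open>q + i\<close>.
      The \<open>z\<close>-values at the ends of their hull differ by exactly
      \<open>\<delta>\<close>.\<close>
    define lo where "lo i = min ((F ^^ i) a + of_int p) ((F ^^ (q + i)) a)" for i
    define hi where "hi i = max ((F ^^ i) b + of_int p) ((F ^^ (q + i)) b)" for i
    have less: "(F ^^ n) a < (F ^^ n) b" for n using \<open>a < b\<close> pow_less by blast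
    have lohi: "lo i < hi i" for i unfolding lo_def hi_def using less[of i] by auto
    have z_lo: "z (lo i) = z a + real i * \<alpha> + min (of_int p) (real q * \<alpha>)" for i
      unfolding lo_def min_of_mono[OF z(1), symmetric] z_int z_pow by (simp add: algebra_simps min_def)
    have z_hi: "z (hi i) = z a + real i * \<alpha> + max (of_int p) (real q * \<alpha>)" for i
      unfolding hi_def max_of_mono[OF z(1), symmetric] z_int z_pow by (simp add: algebra_simps max_def zab)
    have hi_lo: "hi i \<le> lo i + 1" for i
    proof (rule ccontr)
      assume "\<not> hi i \<le> lo i + 1"
      then have "z (lo i + 1) \<le> z (hi i)" by (intro z_le) simp
      then show False using \<open>\<delta> < 1\<close> z_lo[of i] z_hi[of i] z(2)[of "lo i"] unfolding \<delta>_def by linarith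
    qed
    \<comment> \<open>If two hulls met modulo 1, their \<open>z\<close>-intervals of length
      \<open>\<delta>\<close> would start within \<open>\<delta>\<close> of each other, and some
      \<open>k\<close> with \<open>0 < k < q\<close> would return as closely as \<open>q\<close>
      does.\<close>
    have "(\<Sum>i<q. V (hi i) - V (lo i)) \<le> C"
    proof (rule sum_increments_disjoint_mod_int[OF V])
      fix i j :: nat and m :: int
      assume ij: "i \<in> {..<q}" "j \<in> {..<q}" "i \<noteq> j"
      show "hi i \<le> lo j + m \<or> hi j + m \<le> lo i"
      proof (rule ccontr)
        assume "\<not> ?thesis"
        then have "z (lo j + m) \<le> z (hi i)" "z (lo i) \<le> z (hi j + m)" by (auto intro!: z_le)
        then have le: "\<bar>(real j - real i) * \<alpha> + m\<bar> \<le> \<delta>"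
          unfolding z_int z_lo z_hi \<delta>_def by (simp add: algebra_simps abs_if min_def max_def split: if_splits)
        show False
        proof (cases "i < j")
          case True
          then have "0 < j - i" "j - i < q" using ij by auto
          then have "\<delta> < \<bar>real (j - i) * \<alpha> - of_int (- m)\<bar>" unfolding \<delta>_def by (rule best)
          also have "real (j - i) = real j - real i" using True by (simp add: of_nat_diff)
          finally show ?thesis using le by simp
        next
          case False
          then have "0 < i - j" "i - j < q" using ij by auto
          then have "\<delta> < \<bar>real (i - j) * \<alpha> - of_int m\<bar>" unfolding \<delta>_def by (rule best)
          also have "real (i - j) = real i - real j" using False by (simp add: of_nat_diff)
          also have "(real i - real j) * \<alpha> - of_int m = - ((real j - real i) * \<alpha> + m)"
            by (simp add: algebra_simps)
          finally show ?thesis using le by simp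
        qed
      qed
    qed (use lohi hi_lo in auto)
    \<comment> \<open>Distortion compares one step of \<open>F\<close> on the two intervals inside a
      hull. The left side telescopes to \<open>2 ln |I| - ln |g^-q I| - ln |g^q I|\<close>.\<close>
    moreover have "(\<Sum>i<q. s i - s (q + i)) \<le> (\<Sum>i<q. V (hi i) - V (lo i))"
    proof (rule sum_mono)
      fix i
      let ?x = "(F ^^ i) a + of_int p" and ?y = "(F ^^ i) b + of_int p"
        and ?x' = "(F ^^ (q + i)) a" and ?y' = "(F ^^ (q + i)) b"
      have "?x < ?y" "?x' < ?y'" using less by simp_all
      then have "\<bar>ln ((F ?y - F ?x) / (?y - ?x)) - ln ((F ?y' - F ?x') / (?y' - ?x'))\<bar> \<le> V (hi i) - V (lo i)"
        by (intro dist hi_lo) (simp_all add: lo_def hi_def)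
      then show "s i - s (q + i) \<le> V (hi i) - V (lo i)"
        by (simp add: s_def L_def lift_map_add_int[OF F])
    qed
    moreover have sum_s: "(\<Sum>i<n. s i - s (q + i)) = ln (L n) - ln (L 0) - (ln (L (q + n)) - ln (L q))" for n
      by (induction n) (auto simp: s_eq)
    moreover have "ln (L 0) \<le> 0" using \<open>b \<le> a + 1\<close> L_pos[of 0] by (simp add: L_def)
    moreover have Lq: "L q = y - x" by (simp add: L_def Fa Fb)
    moreover have Lqq: "L (q + q) = len q" by (simp add: L_def len_def funpow_add Fa Fb)
    ultimately have "2 * ln (y - x) - C \<le> ln (len q)"
      using sum_s[of q, unfolded Lqq Lq] by linarith
    moreover have "ln \<epsilon> = 2 * ln (y - x) - C" using xy by (simp add: \<epsilon>_def ln_mult ln_realpow)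
    moreover have "len q > 0" using xy pow_less by (simp add: len_def)
    ultimately have "ln \<epsilon> \<le> ln (len q)" "len q > 0" by simp_all
    then have "\<epsilon> \<le> len q" using \<open>\<epsilon> > 0\<close> by simp
    then show False using N[of q] q by linarith
  qed
  \<comment> \<open>The range of \<open>z\<close> contains the dense set of values
    \<open>z 0 + real n * \<alpha> + of_int m\<close>, so the monotone \<open>z\<close> cannot
    jump.\<close>
  moreover have "continuous_on UNIV z"
  proof (rule mono_dense_range_imp_continuous[OF z(1)])
    fix u v :: real assume "u < v"
    then obtain n m where "u - z 0 < real n * \<alpha> + of_int m" "real n * \<alpha> + of_int m < v - z 0"
      using dense_multiples_mod_int[OF irr, of "u - z 0" "v - z 0"] by auto
    then have "u < z ((F ^^ n) 0 + of_int m)" "z ((F ^^ n) 0 + of_int m) < v"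
      by (simp_all add: z_int z_pow)
    then show "\<exists>x. u < z x \<and> z x < v" by blast
  qed
  ultimately have "lift_map z" using z(2) by (simp add: lift_map_def)
  then show ?thesis using z(3) by (rule that)
qed

section \<open>Contraction by a group with a dense set of translations\<close>

text \<open>Periods of a nonconstant continuous function are bounded away from 0, so their infimum
  is attained and divides every period, in particular 1. The factor \<open>k\<close> later makes
  intervals modulo \<open>p\<close> well defined on the circle.\<close>

lemma minimal_period:
  fixes \<phi> :: "real \<Rightarrow> real"
  assumes cont: "continuous_on UNIV \<phi>" and per: "\<And>x. \<phi> (x + 1) = \<phi> x"
    and nonconst: "\<phi> u \<noteq> \<phi> v"
  obtains p k where "p > 0" "\<And>x. \<phi> (x + p) = \<phi> x" "1 = of_int k * p"
    "\<And>s. 0 < s \<Longrightarrow> s < p \<Longrightarrow> \<exists>x. \<phi> (x + s) \<noteq> \<phi> x"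
proof -
  define P where "P = {t. t > 0 \<and> (\<forall>x. \<phi> (x + t) = \<phi> x)}"
  have P1: "1 \<in> P" using per by (simp add: P_def)
  have P_int: "\<phi> (x + of_int k * t) = \<phi> x" if "t \<in> P" for t x k
    using that commutes_translation_int[of \<phi> t 0] by (simp add: P_def)
  have P_diff: "t - of_int k * t' \<in> P" if "t \<in> P" "t' \<in> P" "of_int k * t' < t" for t t' k
  proof -
    have "\<phi> (x + (t - of_int k * t')) = \<phi> x" for x
    proof -
      have "\<phi> (x + t + of_int (- k) * t') = \<phi> (x + t)" by (rule P_int[OF that(2)])
      also have "\<dots> = \<phi> x" using that(1) by (simp add: P_def)
      finally show ?thesis by (simp add: algebra_simps)
    qed
    then show ?thesis using that(3) by (simp add: P_def)
  qed
  \<comment> \<open>Multiples of a tiny period would carry \<open>u\<close> close to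
    \<open>v\<close>, against continuity at \<open>v\<close>.\<close>
  have "\<exists>\<delta>>0. \<forall>t\<in>P. \<delta> \<le> t"
  proof (rule ccontr)
    assume "\<not> ?thesis"
    then have small: "\<exists>t\<in>P. t < \<delta>" if "\<delta> > 0" for \<delta> using that by (meson not_le)
    have "continuous (at v) \<phi>" using cont by (simp add: continuous_on_eq_continuous_at)
    moreover have "0 < \<bar>\<phi> u - \<phi> v\<bar>" using nonconst by simp
    ultimately obtain \<delta> where \<delta>: "\<delta> > 0" "\<And>y. \<bar>y - v\<bar> < \<delta> \<Longrightarrow> \<bar>\<phi> y - \<phi> v\<bar> < \<bar>\<phi> u - \<phi> v\<bar>"
      unfolding continuous_at_eps_delta dist_real_def by blast
    obtain t where t: "t \<in> P" "t < \<delta>" using small \<delta>(1) by blast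
    define k where "k = \<lfloor>(v - u) / t\<rfloor>"
    have "t > 0" using t by (simp add: P_def)
    have "of_int k \<le> (v - u) / t" "(v - u) / t < of_int k + 1" unfolding k_def by linarith+
    then have "of_int k * t \<le> v - u" "v - u < of_int k * t + t"
      using \<open>t > 0\<close> by (simp_all add: field_simps)
    then have "\<bar>(u + of_int k * t) - v\<bar> < \<delta>" using t by linarith
    then show False using \<delta>(2) P_int[OF t(1), of u k] by fastforce
  qed
  then obtain \<delta> where \<delta>: "\<delta> > 0" "\<And>t. t \<in> P \<Longrightarrow> \<delta> \<le> t" by blast
  define p where "p = Inf P"
  have bdd: "bdd_below P" using \<delta>(2) by (meson bdd_belowI)
  have p_le: "p \<le> t" if "t \<in> P" for t unfolding p_def by (rule cInf_lower[OF that bdd])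
  have near: "\<exists>t\<in>P. t < y" if "p < y" for y
    using that P1 unfolding p_def by (metis cInf_lessD empty_iff)
  \<comment> \<open>Otherwise two distinct periods lie within \<open>\<delta>\<close> above
    \<open>p\<close>, and their difference is a period below \<open>\<delta>\<close>.\<close>
  have "p \<in> P"
  proof (rule ccontr)
    assume "p \<notin> P"
    obtain t where t: "t \<in> P" "t < p + \<delta>" using near[of "p + \<delta>"] \<delta>(1) by auto
    then have "p < t" using p_le[of t] \<open>p \<notin> P\<close> by (metis order_le_less)
    then obtain t' where t': "t' \<in> P" "t' < t" using near by blast
    then have "t - t' \<in> P" using P_diff[OF t(1) t'(1), of 1] by simp
    then show False using \<delta>(2)[of "t - t'"] p_le[OF t'(1)] t by simp
  qed
  then have "p > 0" by (simp add: P_def)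
  define k where "k = \<lfloor>1 / p\<rfloor>"
  have "of_int k \<le> 1 / p" "1 / p < of_int k + 1" unfolding k_def by linarith+
  then have k: "of_int k * p \<le> 1" "1 < of_int k * p + p" using \<open>p > 0\<close> by (simp_all add: field_simps)
  have "1 = of_int k * p"
  proof (rule ccontr)
    assume "1 \<noteq> of_int k * p"
    then have "1 - of_int k * p \<in> P" using P_diff[OF P1 \<open>p \<in> P\<close>] k by simp
    then show False using p_le k by fastforce
  qed
  moreover have "\<exists>x. \<phi> (x + s) \<noteq> \<phi> x" if "0 < s" "s < p" for s
    using that p_le[of s] by (force simp: P_def)
  moreover have "\<phi> (x + p) = \<phi> x" for x using \<open>p \<in> P\<close> by (simp add: P_def)
  ultimately show ?thesis using that \<open>p > 0\<close> by metis
qed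

text \<open>Along \<open>x, x + s, x + 2 s, ...\<close> the values never decrease, yet some positive
  multiple of \<open>s\<close> is almost a multiple of \<open>p\<close>, which brings the value back
  near \<open>\<phi> x\<close>. An increase in the first step could not be undone.\<close>

lemma monotone_shift_imp_period:
  fixes \<phi> :: "real \<Rightarrow> real"
  assumes cont: "continuous_on UNIV \<phi>" and "p > 0" and per: "\<And>x. \<phi> (x + p) = \<phi> x"
    and "s > 0" and le: "\<And>x. \<phi> x \<le> \<phi> (x + s)"
  shows "\<phi> (x + s) = \<phi> x"
proof (rule ccontr)
  assume "\<phi> (x + s) \<noteq> \<phi> x"
  then have pos: "\<phi> (x + s) - \<phi> x > 0" using le[of x] by simp
  have "continuous (at x) \<phi>" using cont by (simp add: continuous_on_eq_continuous_at)
  then obtain \<delta> where \<delta>: "\<delta> > 0" "\<And>y. \<bar>y - x\<bar> < \<delta> \<Longrightarrow> \<bar>\<phi> y - \<phi> x\<bar> < \<phi> (x + s) - \<phi> x"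
    using pos unfolding continuous_at_eps_delta dist_real_def by blast
  obtain M :: nat where M: "1 / M < \<delta> / p" "M > 0"
    using \<delta>(1) \<open>p > 0\<close> by (metis divide_pos_pos gr_zeroI inverse_eq_divide real_arch_inverse)
  obtain h k where hk: "0 < k" "\<bar>of_int k * (s / p) - of_int h\<bar> < 1 / M"
    using Dirichlet_approx[OF M(2), of "s / p"] by metis
  have "\<bar>of_int k * s - of_int h * p\<bar> = p * \<bar>of_int k * (s / p) - of_int h\<bar>"
    using \<open>p > 0\<close> by (simp add: abs_mult[symmetric] field_simps)
  also have "\<dots> < p * (\<delta> / p)"
    using hk M \<open>p > 0\<close> by (intro mult_strict_left_mono) auto
  finally have "\<bar>(x + of_int k * s + of_int (- h) * p) - x\<bar> < \<delta>" using \<open>p > 0\<close> by simp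
  then have "\<bar>\<phi> (x + of_int k * s + of_int (- h) * p) - \<phi> x\<bar> < \<phi> (x + s) - \<phi> x" by (rule \<delta>(2))
  moreover have "\<phi> (x + of_int k * s + of_int (- h) * p) = \<phi> (x + of_int k * s)"
    using commutes_translation_int[of \<phi> p 0 "x + of_int k * s" "- h"] per by simp
  moreover have "\<phi> (x + s) \<le> \<phi> (x + real (Suc n) * s)" for n
  proof (induction n)
    case (Suc n)
    then show ?case using le[of "x + real (Suc n) * s"] by (simp add: algebra_simps)
  qed simp
  from this[of "nat k - 1"] have "\<phi> (x + s) \<le> \<phi> (x + of_int k * s)"
    using hk(1) by (simp add: of_nat_diff Suc_diff_le)
  ultimately show False by simp
qed

text \<open>Let \<open>m\<close> be the infimum of the lengths to which members of \<open>N\<close>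
  bring intervals of length \<open>s\<close>. If \<open>m > 0\<close>, then \<open>H\<close> brings
  some interval of length \<open>m\<close>, and all intervals near it, below \<open>m\<close>. A
  member of \<open>N\<close> that almost reaches \<open>m\<close>, a translation to that place and
  then \<open>H\<close> would beat the infimum.\<close>

lemma exists_contraction:
  fixes N :: "(real \<Rightarrow> real) set"
  assumes comp: "\<And>F K. F \<in> N \<Longrightarrow> K \<in> N \<Longrightarrow> (\<lambda>x. F (K x)) \<in> N"
    and mono: "\<And>F. F \<in> N \<Longrightarrow> strict_mono F"
    and per: "\<And>F x. F \<in> N \<Longrightarrow> F (x + p) = F x + p"
    and trans: "\<And>a b. a < b \<Longrightarrow> \<exists>t. a < t \<and> t < b \<and> (\<lambda>x. x + t) \<in> N"
    and H: "H \<in> N" "continuous_on UNIV H"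
    and no_period: "\<And>s. 0 < s \<Longrightarrow> s < p \<Longrightarrow> \<exists>x. H (x + s) \<noteq> H x + s"
    and s: "0 < s" "s < p" and "\<epsilon> > 0"
  obtains F x where "F \<in> N" "F (x + s) - F x < \<epsilon>"
proof -
  define D where "D = {F (x + s) - F x | F x. F \<in> N}"
  have "p > 0" using s by linarith
  have D_pos: "l > 0" if "l \<in> D" for l
    using that mono s by (auto simp: D_def strict_mono_def)
  define m where "m = Inf D"
  have bdd: "bdd_below D" using D_pos by (meson bdd_belowI less_imp_le)
  have m_le: "m \<le> l" if "l \<in> D" for l unfolding m_def by (rule cInf_lower[OF that bdd])
  have ne: "D \<noteq> {}" using H by (auto simp: D_def)
  have near: "\<exists>l\<in>D. l < y" if "m < y" for y
    using that ne unfolding m_def by (metis cInf_lessD)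
  have "m \<ge> 0" unfolding m_def using ne D_pos less_imp_le by (intro cInf_greatest) auto
  \<comment> \<open>A translation keeps the length \<open>s\<close>, so
    \<open>m \<le> s < p\<close>, which brings \<open>m\<close> within reach of
    \<open>no_period\<close>.\<close>
  obtain t where "(\<lambda>x. x + t) \<in> N" using trans[of 0 1] by auto
  then have "s \<in> D" unfolding D_def by (force intro!: exI[of _ "\<lambda>x. x + t"])
  then have "m < p" using m_le s by fastforce
  have "m = 0"
  proof (rule ccontr)
    assume "m \<noteq> 0"
    then have "m > 0" using \<open>m \<ge> 0\<close> by simp
    \<comment> \<open>If \<open>H\<close> shortened no interval of length \<open>m\<close>, its
      displacement would never decrease under the shift by \<open>m\<close>, hence would have period
      \<open>m\<close>.\<close>
    have "\<exists>x. H (x + m) - H x < m"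
    proof (rule ccontr)
      assume "\<not> ?thesis"
      then have "m \<le> H (x + m) - H x" for x by (simp add: not_less)
      then have le: "H x - x \<le> H (x + m) - (x + m)" for x by (smt (verit))
      obtain x where "H (x + m) \<noteq> H x + m" using no_period \<open>m > 0\<close> \<open>m < p\<close> by blast
      moreover have "H (x + m) - (x + m) = H x - x"
        using monotone_shift_imp_period[of "\<lambda>x. H x - x" p m, OF _ \<open>p > 0\<close> _ \<open>m > 0\<close> le]
          per[OF H(1)] H(2) by (simp add: continuous_intros)
      ultimately show False by simp
    qed
    then obtain x where x: "H (x + m) - H x < m" by blast
    define g where "g v = H (fst v + snd v) - H (fst v)" for v :: "real \<times> real"
    have "continuous_on UNIV g"
      unfolding g_def by (intro continuous_intros continuous_on_compose2[OF H(2)]) auto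
    then have "open (g -` {..<m})" by (simp add: open_vimage)
    moreover have "(x, m) \<in> g -` {..<m}" using x by (simp add: g_def)
    ultimately obtain U W where UW: "open U" "open W" "x \<in> U" "m \<in> W" "U \<times> W \<subseteq> g -` {..<m}"
      by (metis open_prod_elim mem_Sigma_iff)
    obtain \<eta> where \<eta>: "\<eta> > 0" "ball x \<eta> \<subseteq> U" using UW openE by blast
    obtain \<theta> where \<theta>: "\<theta> > 0" "ball m \<theta> \<subseteq> W" using UW openE by blast
    obtain l where l: "l \<in> D" "l < m + \<theta>" using near[of "m + \<theta>"] \<theta> by auto
    then obtain F y where F: "F \<in> N" "l = F (y + s) - F y" by (auto simp: D_def)
    obtain t where t: "x - F y - \<eta> < t" "t < x - F y + \<eta>" "(\<lambda>x. x + t) \<in> N"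
      using trans[of "x - F y - \<eta>" "x - F y + \<eta>"] \<eta> by auto
    have "F y + t \<in> U" using t \<eta>(2) by (auto simp: dist_real_def)
    moreover have "l \<in> W" using l m_le[OF l(1)] \<theta>(2) by (auto simp: dist_real_def)
    ultimately have "g (F y + t, l) < m" using UW by blast
    then have "H (F (y + s) + t) - H (F y + t) < m" by (simp add: g_def F(2) algebra_simps)
    moreover have "(\<lambda>y. H (F y + t)) \<in> N"
      using comp[OF H(1) comp[OF t(3) F(1)]] by simp
    then have "H (F (y + s) + t) - H (F y + t) \<in> D" unfolding D_def by auto
    ultimately show False using m_le by fastforce
  qed
  then obtain l where "l \<in> D" "l < \<epsilon>" using near \<open>\<epsilon> > 0\<close> by blast
  then show ?thesis using that by (auto simp: D_def)
qed

text \<open>On \<open>\<real>/p\<int>\<close> a member of \<open>N\<close> squeezes an arc of length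
  \<open>p - r\<close> into less than \<open>r\<close>; translations before and after it place the
  complementary arc and the image. The arcs have length \<open>2 * r\<close> because the
  translations are only dense: the spare \<open>r\<close> is their tolerance.\<close>

lemma exists_hyperbolic:
  fixes N :: "(real \<Rightarrow> real) set"
  assumes comp: "\<And>F K. F \<in> N \<Longrightarrow> K \<in> N \<Longrightarrow> (\<lambda>x. F (K x)) \<in> N"
    and mono: "\<And>F. F \<in> N \<Longrightarrow> strict_mono F"
    and per: "\<And>F x. F \<in> N \<Longrightarrow> F (x + p) = F x + p"
    and trans: "\<And>a b. a < b \<Longrightarrow> \<exists>t. a < t \<and> t < b \<and> (\<lambda>x. x + t) \<in> N"
    and H: "H \<in> N" "continuous_on UNIV H"
    and no_period: "\<And>s. 0 < s \<Longrightarrow> s < p \<Longrightarrow> \<exists>x. H (x + s) \<noteq> H x + s"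
    and "p > 0" "r > 0" "2 * r < p"
  obtains F where "F \<in> N"
    "\<And>y. \<lbrakk>\<And>k::int. \<not> (c < y + of_int k * p \<and> y + of_int k * p < c + 2 * r)\<rbrakk> \<Longrightarrow>
      \<exists>k::int. d < F y + of_int k * p \<and> F y + of_int k * p < d + 2 * r"
proof -
  obtain F x where F: "F \<in> N" "F (x + (p - r)) - F x < r"
    using exists_contraction[where N = N and p = p and H = H and s = "p - r" and \<epsilon> = r] assms by auto
  \<comment> \<open>Any such \<open>v\<close> puts the omitted arc from \<open>x + p - r - v\<close>
    to \<open>x + p - v\<close> inside \<open>(c, c + 2 * r)\<close>.\<close>
  obtain v where v: "x + (p - r) - c - r < v" "v < x + (p - r) - c" "(\<lambda>x. x + v) \<in> N"
    using trans[of "x + (p - r) - c - r" "x + (p - r) - c"] \<open>r > 0\<close> by auto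
  obtain u where u: "d - F x < u" "u < d - F x + r" "(\<lambda>x. x + u) \<in> N"
    using trans[of "d - F x" "d - F x + r"] \<open>r > 0\<close> by auto
  show ?thesis
  proof (rule that)
    show "(\<lambda>y. F (y + v) + u) \<in> N" using comp[OF u(3) comp[OF F(1) v(3)]] by simp
    fix y
    assume out: "\<And>k::int. \<not> (c < y + of_int k * p \<and> y + of_int k * p < c + 2 * r)"
    define k where "k = - \<lfloor>(y + v - x) / p\<rfloor>"
    have "of_int (-k) \<le> (y + v - x) / p" "(y + v - x) / p < of_int (-k) + 1"
      unfolding k_def by linarith+
    then have k: "x \<le> y + v + of_int k * p" "y + v + of_int k * p < x + p"
      using \<open>p > 0\<close> by (simp_all add: field_simps)
    have "y + v + of_int k * p \<le> x + (p - r)" using out[of k] k v by linarith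
    then have "F x \<le> F (y + v + of_int k * p)" "F (y + v + of_int k * p) \<le> F (x + (p - r))"
      using k mono[OF F(1)] by (simp_all add: strict_mono_less_eq)
    moreover have "F (y + v + of_int k * p) = F (y + v) + of_int k * p"
      using commutes_translation_int[of F p p] per[OF F(1)] by simp
    ultimately show "\<exists>k::int. d < F (y + v) + u + of_int k * p \<and> F (y + v) + u + of_int k * p < d + 2 * r"
      using F(2) u by (intro exI[of _ k]) linarith
  qed
qed

section \<open>Distortion bounds\<close>

text \<open>The hypothesis of \<open>Denjoy\<close> on \<open>V\<close> as a property of the map.
  \<open>V\<close> may be discontinuous, so that a jump can absorb the change of slope at a
  breakpoint.\<close>

definition bounded_distortion :: "(real \<Rightarrow> real) \<Rightarrow> bool" where
  "bounded_distortion F \<longleftrightarrow> (\<exists>V C. mono V \<and> (\<forall>x. V (x + 1) = V x + C) \<and>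
     (\<forall>a b x y x' y'. a \<le> x \<and> x < y \<and> y \<le> b \<and> a \<le> x' \<and> x' < y' \<and> y' \<le> b \<and> b \<le> a + 1 \<longrightarrow>
       \<bar>ln ((F y - F x) / (y - x)) - ln ((F y' - F x') / (y' - x'))\<bar> \<le> V b - V a))"

section \<open>Derivatives of bounded variation\<close>

text \<open>\<open>v x\<close> is the supremum of the variation sums over partitions inside
  \<open>[a, x]\<close>. Appending \<open>x\<close> and \<open>y\<close> to such a partition adds at
  least \<open>\<bar>h y - h x\<bar>\<close>.\<close>

lemma bounded_variation_on_variation_function:
  assumes "bounded_variation_on h a b"
  obtains v where "\<And>x y. a \<le> x \<Longrightarrow> x \<le> y \<Longrightarrow> y \<le> b \<Longrightarrow> \<bar>h y - h x\<bar> \<le> v y - v x"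
proof -
  define S where "S x = {\<Sum>i<n. \<bar>h (t (Suc i)) - h (t i)\<bar> | n t. t ` {..n} \<subseteq> {a..x} \<and> mono_on {..n::nat} t}" for x
  obtain M where M: "\<And>(n::nat) t. t ` {..n} \<subseteq> {a..b} \<and> mono_on {..n} t \<Longrightarrow>
        (\<Sum>i<n. \<bar>h (t (Suc i)) - h (t i)\<bar>) \<le> M"
    using assms unfolding bounded_variation_on_def by blast
  have bdd: "bdd_above (S x)" if "x \<le> b" for x
  proof (rule bdd_aboveI)
    fix l assume "l \<in> S x"
    then obtain n t where l: "l = (\<Sum>i<n. \<bar>h (t (Suc i)) - h (t i)\<bar>)"
      and t: "t ` {..n} \<subseteq> {a..x}" "mono_on {..n::nat} t"
      unfolding S_def by blast
    have "t ` {..n} \<subseteq> {a..b}" using t(1) that by fastforce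
    then show "l \<le> M" unfolding l using t(2) by (intro M conjI)
  qed
  have ne: "S x \<noteq> {}" if "a \<le> x" for x
    unfolding S_def using that by (auto intro!: exI[of _ "0::nat"] exI[of _ "\<lambda>_. a"] simp: mono_on_def)
  have "\<bar>h y - h x\<bar> \<le> Sup (S y) - Sup (S x)" if xy: "a \<le> x" "x \<le> y" "y \<le> b" for x y
  proof -
    have "l + \<bar>h y - h x\<bar> \<le> Sup (S y)" if lS: "l \<in> S x" for l
    proof -
      obtain n t where l: "l = (\<Sum>i<n. \<bar>h (t (Suc i)) - h (t i)\<bar>)"
        and t: "t ` {..n} \<subseteq> {a..x}" "mono_on {..n::nat} t"
        using lS unfolding S_def by blast
      define t' where "t' i = (if i \<le> n then t i else if i = Suc n then x else y)" for i
      have in_t: "t i \<in> {a..x}" if "i \<le> n" for i using t(1) that by auto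
      have "t' ` {..Suc (Suc n)} \<subseteq> {a..y}" using in_t xy by (fastforce simp: t'_def)
      moreover have "mono_on {..Suc (Suc n)} t'"
        using t(2) in_t xy by (fastforce simp: mono_on_def t'_def)
      ultimately have "(\<Sum>i<Suc (Suc n). \<bar>h (t' (Suc i)) - h (t' i)\<bar>) \<in> S y" unfolding S_def by blast
      then have "(\<Sum>i<Suc (Suc n). \<bar>h (t' (Suc i)) - h (t' i)\<bar>) \<le> Sup (S y)"
        using bdd[OF xy(3)] by (rule cSup_upper)
      moreover have "(\<Sum>i<n. \<bar>h (t' (Suc i)) - h (t' i)\<bar>) = l"
        unfolding l by (rule sum.cong) (auto simp: t'_def)
      ultimately show ?thesis by (simp add: t'_def)
    qed
    then have "Sup (S x) \<le> Sup (S y) - \<bar>h y - h x\<bar>"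
      using ne[OF xy(1)] by (intro cSup_least) (auto simp: le_diff_eq)
    then show ?thesis by simp
  qed
  then show ?thesis by (rule that)
qed

text \<open>The variation function on \<open>[0,1]\<close> is continued by adding \<open>C\<close>
  per period. If \<open>x\<close> and \<open>y\<close> have different integer parts, the way between
  them is cut at integers, where \<open>h\<close> has the single value
  \<open>h 0 = h 1\<close>.\<close>

lemma periodic_variation_function:
  assumes "bounded_variation_on h 0 1" and per: "\<And>x. h (x + 1) = h x"
  obtains W C where "\<And>x. W (x + 1) = W x + C" "\<And>x y. x \<le> y \<Longrightarrow> \<bar>h y - h x\<bar> \<le> W y - W x"
proof -
  obtain v where v: "\<And>x y. 0 \<le> x \<Longrightarrow> x \<le> y \<Longrightarrow> y \<le> 1 \<Longrightarrow> \<bar>h y - h x\<bar> \<le> v y - v x"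
    using bounded_variation_on_variation_function[OF assms(1)] by blast
  have h_int: "h (x + of_int k) = h x" for x k
    using commutes_translation_int[of h 1 0] per by simp
  have h_frac: "h (frac x) = h x" for x
    using h_int[of x "- \<lfloor>x\<rfloor>"] by (simp add: frac_def)
  define C where "C = v 1 - v 0"
  define W where "W x = v (frac x) + of_int \<lfloor>x\<rfloor> * C" for x
  have "C \<ge> 0" using v[of 0 1] by (simp add: C_def)
  show ?thesis
  proof (rule that)
    show "W (x + 1) = W x + C" for x by (simp add: W_def frac_def algebra_simps)
    fix x y :: real
    assume "x \<le> y"
    have fx: "0 \<le> frac x" "frac x \<le> 1" "0 \<le> frac y" "frac y \<le> 1"
      by (simp_all add: less_imp_le frac_lt_1)
    show "\<bar>h y - h x\<bar> \<le> W y - W x"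
    proof (cases "\<lfloor>x\<rfloor> = \<lfloor>y\<rfloor>")
      case True
      then have "frac x \<le> frac y" using \<open>x \<le> y\<close> by (simp add: frac_def)
      then show ?thesis using v[of "frac x" "frac y"] True fx by (simp add: h_frac W_def)
    next
      case False
      then have "of_int \<lfloor>x\<rfloor> + 1 \<le> (of_int \<lfloor>y\<rfloor> :: real)"
        using floor_mono[OF \<open>x \<le> y\<close>] by linarith
      then have "(of_int \<lfloor>x\<rfloor> + 1) * C \<le> of_int \<lfloor>y\<rfloor> * C"
        using \<open>C \<ge> 0\<close> by (rule mult_right_mono)
      moreover have "\<bar>h 1 - h x\<bar> \<le> v 1 - v (frac x)" "\<bar>h y - h 0\<bar> \<le> v (frac y) - v 0"
        using v[of "frac x" 1] v[of 0 "frac y"] fx by (simp_all add: h_frac)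
      moreover have "h 1 = h 0" using per[of 0] by simp
      ultimately show ?thesis by (simp add: W_def C_def algebra_simps)
    qed
  qed
qed

lemma abs_ln_diff_le:
  fixes u w c :: real
  assumes "c > 0" "c \<le> u" "c \<le> w"
  shows "\<bar>ln u - ln w\<bar> \<le> \<bar>u - w\<bar> / c"
proof -
  have *: "ln u - ln w \<le> \<bar>u - w\<bar> / c" if "c \<le> u" "c \<le> w" for u w
  proof -
    have "ln u - ln w = ln (u / w)" using that \<open>c > 0\<close> by (simp add: ln_div)
    also have "\<dots> \<le> u / w - 1" using that \<open>c > 0\<close> by (intro ln_le_minus_one) simp
    also have "\<dots> = (u - w) / w" using that \<open>c > 0\<close> by (simp add: field_simps)
    also have "\<dots> \<le> \<bar>u - w\<bar> / w" using that \<open>c > 0\<close> by (intro divide_right_mono) auto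
    also have "\<dots> \<le> \<bar>u - w\<bar> / c" using that \<open>c > 0\<close> by (intro divide_left_mono) auto
    finally show ?thesis .
  qed
  then show ?thesis using *[of u w] *[of w u] assms by (simp add: abs_le_iff abs_minus_commute)
qed

text \<open>The mean value theorem turns the quotients into values of \<open>F'\<close> at points of
  \<open>[a, b]\<close>. By periodicity and compactness \<open>F'\<close> has a positive minimum
  \<open>c\<close>, and \<open>ln\<close> is Lipschitz with constant \<open>1 / c\<close> above it,
  so the variation of \<open>F'\<close> divided by \<open>c\<close> controls that of
  \<open>ln F'\<close>.\<close>

lemma bounded_distortion_C1:
  assumes F: "lift_map F" and der: "\<And>x. (F has_real_derivative F' x) (at x)"
    and pos: "\<And>x. F' x > 0" and cont: "continuous_on UNIV F'" and bv: "bounded_variation_on F' 0 1"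
  shows "bounded_distortion F"
proof -
  have per: "F' (x + 1) = F' x" for x
  proof -
    have "((\<lambda>x. F (x + 1)) has_real_derivative F' (x + 1) * 1) (at x)"
      by (rule DERIV_chain2[OF der]) (auto intro!: derivative_eq_intros)
    moreover have "(\<lambda>x. F (x + 1)) = (\<lambda>x. F x + 1)" using F by (simp add: lift_map_def)
    moreover have "((\<lambda>x. F x + 1) has_real_derivative F' x) (at x)"
      by (auto intro!: derivative_eq_intros der)
    ultimately show ?thesis by (metis DERIV_unique mult_1_right)
  qed
  obtain W C where W: "\<And>x. W (x + 1) = W x + C" "\<And>x y. x \<le> y \<Longrightarrow> \<bar>F' y - F' x\<bar> \<le> W y - W x"
    using periodic_variation_function[OF bv per] by blast
  obtain x0 where x0: "x0 \<in> {0..1}" "\<And>x. x \<in> {0..1} \<Longrightarrow> F' x0 \<le> F' x"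
    using continuous_attains_inf[of "{0..1::real}" F'] continuous_on_subset[OF cont] by auto
  define c where "c = F' x0"
  have "c > 0" using pos by (simp add: c_def)
  have c_le: "c \<le> F' x" for x
  proof -
    have "F' (x + of_int (- \<lfloor>x\<rfloor>)) = F' x"
      using commutes_translation_int[of F' 1 0 x "- \<lfloor>x\<rfloor>"] per by simp
    moreover have "x + of_int (- \<lfloor>x\<rfloor>) \<in> {0..1}" by (auto; linarith)
    ultimately show ?thesis using x0(2) unfolding c_def by metis
  qed
  have mono: "W x \<le> W y" if "x \<le> y" for x y using W(2)[OF that] by linarith
  have mvt: "\<exists>\<xi>. x < \<xi> \<and> \<xi> < y \<and> (F y - F x) / (y - x) = F' \<xi>" if xy: "x < y" for x y
  proof -
    obtain \<xi> where "x < \<xi>" "\<xi> < y" "F y - F x = (y - x) * F' \<xi>"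
      using MVT2[OF xy, where f = F and f' = F'] der by blast
    then show ?thesis using xy by (intro exI[of _ \<xi>]) simp
  qed
  show ?thesis unfolding bounded_distortion_def
  proof (intro exI[of _ "\<lambda>x. W x / c"] exI[of _ "C / c"] conjI allI impI)
    show "mono (\<lambda>x. W x / c)" using mono \<open>c > 0\<close> by (intro monoI divide_right_mono) auto
    show "W (x + 1) / c = W x / c + C / c" for x by (simp add: W(1) add_divide_distrib)
    fix a b x y x' y' :: real
    assume *: "a \<le> x \<and> x < y \<and> y \<le> b \<and> a \<le> x' \<and> x' < y' \<and> y' \<le> b \<and> b \<le> a + 1"
    obtain \<xi> \<xi>' where \<xi>: "x < \<xi>" "\<xi> < y" "(F y - F x) / (y - x) = F' \<xi>"
      "x' < \<xi>'" "\<xi>' < y'" "(F y' - F x') / (y' - x') = F' \<xi>'"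
      using mvt[of x y] mvt[of x' y'] * by blast
    have le: "\<bar>F' \<xi> - F' \<xi>'\<bar> \<le> W b - W a"
    proof (cases "\<xi> \<le> \<xi>'")
      case True
      then show ?thesis using W(2)[OF True] mono[of a \<xi>] mono[of \<xi>' b] * \<xi> by linarith
    next
      case False
      then show ?thesis using W(2)[of \<xi>' \<xi>] mono[of a \<xi>'] mono[of \<xi> b] * \<xi> by linarith
    qed
    have "\<bar>ln (F' \<xi>) - ln (F' \<xi>')\<bar> \<le> \<bar>F' \<xi> - F' \<xi>'\<bar> / c"
      by (rule abs_ln_diff_le[OF \<open>c > 0\<close> c_le c_le])
    also have "\<dots> \<le> (W b - W a) / c" using le \<open>c > 0\<close> by (intro divide_right_mono) auto
    finally show "\<bar>ln ((F y - F x) / (y - x)) - ln ((F y' - F x') / (y' - x'))\<bar> \<le> W b / c - W a / c"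
      unfolding \<xi>(3,6) by (simp add: diff_divide_distrib)
  qed
qed

section \<open>Piecewise linear maps\<close>

text \<open>\<open>deriv F\<close> is locally constant on the open interval, hence constant.
  Continuity carries the formula to the ends, where breakpoints may lie.\<close>

lemma locally_affine_imp_affine:
  fixes F :: "real \<Rightarrow> real"
  assumes "a < b" and cont: "continuous_on {a..b} F"
    and aff: "\<And>x. a < x \<Longrightarrow> x < b \<Longrightarrow> \<exists>p q. eventually (\<lambda>y. F y = p * y + q) (nhds x)"
  obtains p q where "\<And>x. a \<le> x \<Longrightarrow> x \<le> b \<Longrightarrow> F x = p * x + q"
proof -
  have D: "\<exists>p. eventually (\<lambda>y. (F has_real_derivative p) (at y)) (nhds x)" if "a < x" "x < b" for x
  proof -
    obtain p q where "eventually (\<lambda>y. F y = p * y + q) (nhds x)" using aff \<open>a < x\<close> \<open>x < b\<close> by blast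
    then have "eventually (\<lambda>z. eventually (\<lambda>y. F y = p * y + q) (nhds z)) (nhds x)"
      by (simp add: eventually_eventually)
    then have "eventually (\<lambda>z. (F has_real_derivative p) (at z)) (nhds x)"
    proof (rule eventually_mono)
      fix z assume ev: "eventually (\<lambda>y. F y = p * y + q) (nhds z)"
      have "((\<lambda>y. p * y + q) has_real_derivative p) (at z)" by (auto intro!: derivative_eq_intros)
      then show "(F has_real_derivative p) (at z)" using DERIV_cong_ev[OF refl ev refl] by blast
    qed
    then show ?thesis by blast
  qed
  have F_der: "(F has_real_derivative deriv F x) (at x)" if "a < x" "x < b" for x
    using D[OF that] eventually_nhds_x_imp_x DERIV_imp_deriv by metis
  have "\<exists>p. \<forall>x\<in>{a<..<b}. deriv F x = p"
  proof (rule has_field_derivative_zero_constant)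
    fix x assume "x \<in> {a<..<b}"
    then obtain p where p: "eventually (\<lambda>y. (F has_real_derivative p) (at y)) (nhds x)" using D by auto
    have "eventually (\<lambda>y. deriv F y = p) (nhds x)"
      by (rule eventually_mono[OF p]) (rule DERIV_imp_deriv)
    then have "(deriv F has_real_derivative 0) (at x)"
      using DERIV_cong_ev[OF refl _ refl, of "deriv F" "\<lambda>_. p" x 0] by simp
    then show "(deriv F has_real_derivative 0) (at x within {a<..<b})" by (rule has_field_derivative_at_within)
  qed simp
  then obtain p where p: "\<And>x. a < x \<Longrightarrow> x < b \<Longrightarrow> deriv F x = p" by auto
  have "F x - p * x = F a - p * a" if "a \<le> x" "x \<le> b" for x
  proof (rule DERIV_isconst2[OF \<open>a < b\<close> _ _ that, where f = "\<lambda>x. F x - p * x"])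
    show "continuous_on {a..b} (\<lambda>x. F x - p * x)" by (intro continuous_intros cont)
    show "((\<lambda>x. F x - p * x) has_real_derivative 0) (at x)" if "a < x" "x < b" for x
      using F_der[OF that] p[OF that] by (auto intro!: derivative_eq_intros)
  qed
  then show ?thesis by (intro that[of p "F a - p * a"]) (simp add: algebra_simps)
qed

text \<open>Induction on the number of breakpoints inside the interval, splitting at one of them:
  increments across the cut add up, so the larger constant serves both sides. Only the part of
  \<open>B\<close> inside is finite, since \<open>B\<close> will be a periodic set.\<close>

lemma piecewise_affine_slope_bound:
  fixes F :: "real \<Rightarrow> real"
  assumes sm: "strict_mono F" and cont: "continuous_on UNIV F"
    and fin: "finite (B \<inter> {a<..<b})" and "a < b"
    and aff: "\<And>x. a < x \<Longrightarrow> x < b \<Longrightarrow> x \<notin> B \<Longrightarrow> \<exists>p q. eventually (\<lambda>y. F y = p * y + q) (nhds x)"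
  shows "\<exists>M\<ge>1. \<forall>x y. a \<le> x \<and> x \<le> y \<and> y \<le> b \<longrightarrow> y - x \<le> M * (F y - F x) \<and> F y - F x \<le> M * (y - x)"
  using fin \<open>a < b\<close> aff
proof (induction "card (B \<inter> {a<..<b})" arbitrary: a b rule: less_induct)
  case less
  show ?case
  proof (cases "B \<inter> {a<..<b} = {}")
    case True
    then have "\<exists>p q. eventually (\<lambda>y. F y = p * y + q) (nhds x)" if "a < x" "x < b" for x
      using less.prems(3)[OF that] True that by fastforce
    then obtain p q where pq: "\<And>x. a \<le> x \<Longrightarrow> x \<le> b \<Longrightarrow> F x = p * x + q"
      using locally_affine_imp_affine[OF less.prems(2) continuous_on_subset[OF cont]] by (metis subset_UNIV)
    have "F a < F b" using sm less.prems(2) by (simp add: strict_mono_def)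
    then have "p * (b - a) > 0" using pq[of a] pq[of b] less.prems(2) by (simp add: algebra_simps)
    then have "p > 0" using less.prems(2) by (simp add: zero_less_mult_iff)
    define M where "M = max 1 (max p (1 / p))"
    have M: "M \<ge> 1" "p \<le> M" "1 \<le> M * p"
    proof -
      have "1 / p \<le> M" by (simp add: M_def)
      then show "1 \<le> M * p" using \<open>p > 0\<close> by (simp add: field_simps)
    qed (simp_all add: M_def)
    show ?thesis
    proof (intro exI[of _ M] conjI allI impI)
      fix x y assume xy: "a \<le> x \<and> x \<le> y \<and> y \<le> b"
      then have eq: "F y - F x = p * (y - x)" using pq[of x] pq[of y] by (simp add: algebra_simps)
      show "F y - F x \<le> M * (y - x)" unfolding eq using M xy by (intro mult_right_mono) auto
      have "1 * (y - x) \<le> (M * p) * (y - x)" using M xy by (intro mult_right_mono) auto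
      then show "y - x \<le> M * (F y - F x)" unfolding eq by (simp add: mult.assoc)
    qed fact
  next
    case False
    then obtain c where c: "c \<in> B" "a < c" "c < b" by auto
    have sub: "B \<inter> {a<..<c} \<subset> B \<inter> {a<..<b}" "B \<inter> {c<..<b} \<subset> B \<inter> {a<..<b}" using c by auto
    note cards = sub[THEN psubset_card_mono[OF less.prems(1)]]
    note fins = sub[THEN psubset_imp_subset, THEN finite_subset, OF less.prems(1)]
    obtain M1 where M1: "M1 \<ge> 1" "\<And>x y. a \<le> x \<and> x \<le> y \<and> y \<le> c \<Longrightarrow> y - x \<le> M1 * (F y - F x) \<and> F y - F x \<le> M1 * (y - x)"
      using less.hyps[OF cards(1) fins(1) c(2)] less.prems(3) c by (meson less_trans)
    obtain M2 where M2: "M2 \<ge> 1" "\<And>x y. c \<le> x \<and> x \<le> y \<and> y \<le> b \<Longrightarrow> y - x \<le> M2 * (F y - F x) \<and> F y - F x \<le> M2 * (y - x)"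
      using less.hyps[OF cards(2) fins(2) c(3)] less.prems(3) c by (meson less_trans)
    define M where "M = max M1 M2"
    have up: "u \<le> M * w" if "u \<le> M1 * w \<or> u \<le> M2 * w" "w \<ge> 0" for u w
    proof -
      have "M1 * w \<le> M * w" "M2 * w \<le> M * w" using that(2) by (auto simp: M_def intro!: mult_right_mono)
      then show ?thesis using that(1) by linarith
    qed
    have F_le: "F x \<le> F y" if "x \<le> y" for x y using sm that by (simp add: strict_mono_less_eq)
    have l: "y - x \<le> M * (F y - F x) \<and> F y - F x \<le> M * (y - x)" if "a \<le> x" "x \<le> y" "y \<le> c" for x y
      using M1(2)[of x y] that up F_le[OF that(2)] by simp
    have r: "y - x \<le> M * (F y - F x) \<and> F y - F x \<le> M * (y - x)" if "c \<le> x" "x \<le> y" "y \<le> b" for x y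
      using M2(2)[of x y] that up F_le[OF that(2)] by simp
    show ?thesis
    proof (intro exI[of _ M] conjI[of "1 \<le> M"] allI impI)
      show "1 \<le> M" using M1(1) by (simp add: M_def)
      fix x y assume xy: "a \<le> x \<and> x \<le> y \<and> y \<le> b"
      consider "y \<le> c" | "c \<le> x" | "x \<le> c" "c \<le> y" by linarith
      then show "y - x \<le> M * (F y - F x) \<and> F y - F x \<le> M * (y - x)"
      proof cases
        case 3
        then show ?thesis using l[of x c] r[of c y] xy by (simp add: algebra_simps)
      qed (use l r xy in auto)
    qed
  qed
qed

text \<open>\<open>V\<close> is a step function that jumps by \<open>2 * ln M\<close> for each
  integer translate of a point of \<open>B\<close>. Without a jump both quotients equal one slope;
  otherwise a single jump pays for two logarithms between \<open>- ln M\<close> and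
  \<open>ln M\<close>.\<close>

lemma bounded_distortion_PL:
  assumes F: "lift_map F" and fin: "finite B"
    and aff: "\<And>x. frac x \<notin> B \<Longrightarrow> \<exists>p q. eventually (\<lambda>y. F y = p * y + q) (nhds x)"
  shows "bounded_distortion F"
proof -
  have sm: "strict_mono F" and cont: "continuous_on UNIV F" using F by (auto simp: lift_map_def)
  let ?B = "{x. frac x \<in> B}"
  have "?B \<inter> {0<..<2} \<subseteq> B \<union> (\<lambda>x. x + 1) ` B"
  proof
    fix x :: real assume x: "x \<in> ?B \<inter> {0<..<2}"
    show "x \<in> B \<union> (\<lambda>x. x + 1) ` B"
    proof (cases "x < 1")
      case True
      then have "frac x = x" using x by (simp add: frac_eq)
      then show ?thesis using x by simp
    next
      case False
      then have "frac x = x - 1" using x by (simp add: frac_unique_iff)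
      then show ?thesis using x by (intro UnI2 image_eqI[of _ _ "frac x"]) auto
    qed
  qed
  then have "finite (?B \<inter> {0<..<2})" using fin by (meson finite_UnI finite_imageI finite_subset)
  \<comment> \<open>The window \<open>[0, 2]\<close> contains an integer translate of every interval
    of length at most 1.\<close>
  then obtain M where M: "M \<ge> 1"
    "\<And>x y. 0 \<le> x \<and> x \<le> y \<and> y \<le> 2 \<Longrightarrow> y - x \<le> M * (F y - F x) \<and> F y - F x \<le> M * (y - x)"
    using piecewise_affine_slope_bound[OF sm cont, of ?B 0 2] aff by auto
  have slope: "\<bar>ln ((F y - F x) / (y - x))\<bar> \<le> ln M" if "x < y" "y \<le> a + 1" "a \<le> x" for x y a
  proof -
    have "y + of_int (- \<lfloor>a\<rfloor>) - (x + of_int (- \<lfloor>a\<rfloor>)) \<le> M * (F (y + of_int (- \<lfloor>a\<rfloor>)) - F (x + of_int (- \<lfloor>a\<rfloor>))) \<and>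
      F (y + of_int (- \<lfloor>a\<rfloor>)) - F (x + of_int (- \<lfloor>a\<rfloor>)) \<le> M * (y + of_int (- \<lfloor>a\<rfloor>) - (x + of_int (- \<lfloor>a\<rfloor>)))"
      using that by (intro M(2)) (simp; linarith)
    then have "y - x \<le> M * (F y - F x)" "F y - F x \<le> M * (y - x)"
      unfolding lift_map_add_int[OF F] by simp_all
    then have q: "(F y - F x) / (y - x) \<le> M" "1 / M \<le> (F y - F x) / (y - x)"
      using that M(1) by (simp_all add: field_simps)
    have "0 < 1 / M" using M(1) by simp
    then have pos: "0 < (F y - F x) / (y - x)" using q(2) by linarith
    have "ln (1 / M) \<le> ln ((F y - F x) / (y - x))" "ln ((F y - F x) / (y - x)) \<le> ln M"
      using pos q \<open>0 < 1 / M\<close> M(1) by (simp_all only: ln_le_cancel_iff)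
    then show ?thesis using M(1) by (simp add: ln_div abs_le_iff)
  qed
  have "ln M \<ge> 0" using M(1) by simp
  \<comment> \<open>\<open>n b - n a\<close> counts, for each point of \<open>B\<close>, its integer
    translates in \<open>(a, b]\<close>. A breakpoint at \<open>a\<close> goes uncounted, which is
    harmless because the affine formula extends to the ends.\<close>
  define n where "n x = (\<Sum>c\<in>B. \<lfloor>x - c\<rfloor>)" for x
  have n_mono: "n x \<le> n y" if "x \<le> y" for x y
    unfolding n_def using that by (intro sum_mono floor_mono) simp
  define V where "V x = 2 * ln M * of_int (n x)" for x
  show ?thesis unfolding bounded_distortion_def
  proof (intro exI[of _ V] exI[of _ "2 * ln M * of_nat (card B)"] conjI allI impI)
    show "mono V" unfolding V_def using n_mono \<open>ln M \<ge> 0\<close> by (intro monoI mult_left_mono) auto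
    show "V (x + 1) = V x + 2 * ln M * real (card B)" for x
    proof -
      have "\<lfloor>x + 1 - c\<rfloor> = \<lfloor>x - c\<rfloor> + 1" for c :: real by linarith
      then have "n (x + 1) = n x + int (card B)" by (simp add: n_def sum.distrib)
      then show ?thesis by (simp add: V_def algebra_simps)
    qed
    fix a b x y x' y' :: real
    assume *: "a \<le> x \<and> x < y \<and> y \<le> b \<and> a \<le> x' \<and> x' < y' \<and> y' \<le> b \<and> b \<le> a + 1"
    show "\<bar>ln ((F y - F x) / (y - x)) - ln ((F y' - F x') / (y' - x'))\<bar> \<le> V b - V a"
    proof (cases "\<exists>c\<in>B. \<lfloor>a - c\<rfloor> < \<lfloor>b - c\<rfloor>")
      case True
      then obtain c where c: "c \<in> B" "\<lfloor>a - c\<rfloor> < \<lfloor>b - c\<rfloor>" by blast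
      have "n a < n b" unfolding n_def
        by (rule sum_strict_mono_ex1[OF fin]) (use c * in \<open>auto intro!: floor_mono\<close>)
      then have "1 \<le> (of_int (n b) - of_int (n a) :: real)" by linarith
      then have "2 * ln M * 1 \<le> 2 * ln M * (of_int (n b) - of_int (n a))"
        using \<open>ln M \<ge> 0\<close> by (intro mult_left_mono) auto
      then have "2 * ln M \<le> V b - V a" by (simp add: V_def algebra_simps)
      then show ?thesis using slope[of x y a] slope[of x' y' a] * by linarith
    next
      case False
      have "frac u \<notin> B" if "a < u" "u < b" for u
      proof
        assume "frac u \<in> B"
        then have "\<not> \<lfloor>a - frac u\<rfloor> < \<lfloor>b - frac u\<rfloor>" using False by blast
        moreover have "\<lfloor>a - frac u\<rfloor> < \<lfloor>u\<rfloor>" "\<lfloor>u\<rfloor> \<le> \<lfloor>b - frac u\<rfloor>"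
          using that by (simp_all add: floor_less_iff le_floor_iff frac_def)
        ultimately show False by simp
      qed
      then have "\<exists>p q. eventually (\<lambda>y. F y = p * y + q) (nhds u)" if "a < u" "u < b" for u
        using that aff by blast
      moreover have "a < b" using * by linarith
      moreover have "continuous_on {a..b} F" by (rule continuous_on_subset[OF cont]) simp
      ultimately obtain p q where pq: "\<And>x. a \<le> x \<Longrightarrow> x \<le> b \<Longrightarrow> F x = p * x + q"
        using locally_affine_imp_affine[of a b F] by blast
      have "(F y - F x) / (y - x) = p" if "a \<le> x" "x < y" "y \<le> b" for x y
        using that pq[of x] pq[of y] by (simp add: field_simps)
      then show ?thesis using * \<open>mono V\<close> by (simp add: monoD)
    qed
  qed
qed

section \<open>Circle homeomorphisms and their lifts\<close>

lemma to_circle_add_int [simp]: "to_circle (x + of_int k) = to_circle x"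
  by (simp add: to_circle_eq_iff)

lemma to_circle_plus: "to_circle (x + y) = to_circle x + to_circle y"
  by (simp add: plus_circle.abs_eq)

lemma is_lift_unique:
  assumes "is_lift f F" "is_lift f F'"
  obtains k :: int where "\<And>x. F' x = F x + of_int k"
proof -
  have ints: "F' x - F x \<in> \<int>" for x
    using assms unfolding is_lift_def by (metis to_circle_eq_iff)
  have c: "continuous_on UNIV (\<lambda>x. F' x - F x)"
    using assms unfolding is_lift_def by (intro continuous_intros) auto
  have "(\<lambda>x. F' x - F x) constant_on UNIV"
  proof (rule continuous_discrete_range_constant[OF connected_UNIV c])
    fix x :: real
    show "\<exists>e>0. \<forall>y. y \<in> UNIV \<and> F' y - F y \<noteq> F' x - F x \<longrightarrow> e \<le> norm (F' y - F y - (F' x - F x))"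
      using ints by (intro exI[of _ 1])
        (metis Ints_diff Ints_nonzero_abs_ge1 real_norm_def right_minus_eq zero_less_one)
  qed
  then obtain d where d: "\<And>x. F' x - F x = d" by (auto simp: constant_on_def)
  then obtain k :: int where "d = of_int k" using ints by (metis Ints_cases)
  then have "F' x = F x + of_int k" for x using d[of x] by linarith
  then show ?thesis by (rule that)
qed

text \<open>An increasing lift could still have degree \<open>k > 1\<close>. Injectivity of
  \<open>f\<close> excludes this, since \<open>F\<close> would take the value \<open>F 0 + 1\<close>
  strictly between 0 and 1.\<close>

lemma Homeo_plus_lift:
  assumes "f \<in> carrier Homeo_plus"
  obtains F where "lift_map F" "is_lift f F"
proof -
  obtain h where h: "homeomorphism UNIV UNIV f h" using assms by (auto simp: Homeo_plus_def)
  then have inj: "inj f" by (metis UNIV_I homeomorphism_apply1 injI)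
  obtain F where F: "is_lift f F" "strict_mono F"
    using assms by (auto simp: Homeo_plus_def orientation_preserving_def)
  obtain k :: int where k: "\<And>x. F (x + 1) = F x + of_int k"
    using is_lift_shift[OF F(1)] by metis
  have "F 0 < F (0 + 1)" using F(2) by (simp add: strict_mono_def)
  then have "0 < k" by (simp only: k less_add_same_cancel1 of_int_0_less_iff)
  have "k = 1"
  proof (rule ccontr)
    assume "k \<noteq> 1"
    then have "k > 1" using \<open>0 < k\<close> by simp
    obtain y where y: "F y = F 0 + 1" using strict_mono_lift_surj[OF F] by (metis surjD)
    have "F 0 < F y" "F y < F (0 + 1)" using y k[of 0] \<open>k > 1\<close> by simp_all
    then have y01: "0 < y" "y < 1" using F(2) by (simp_all add: strict_mono_less)
    have "to_circle (F y) = to_circle (F 0)" unfolding y by (simp add: to_circle_eq_iff)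
    then have "f (to_circle y) = f (to_circle 0)" using F(1) by (simp add: is_lift_def)
    then have "to_circle y = to_circle 0" using inj by (simp add: inj_eq)
    then have "y \<in> \<int>" by (simp add: to_circle_eq_iff)
    then show False using y01 by (metis Ints_cases of_int_0_less_iff of_int_less_1_iff zless_imp_add1_zle add_0 not_le)
  qed
  then have "lift_map F" using F k by (simp add: lift_map_def is_lift_def)
  then show ?thesis using F(1) by (rule that)
qed

lemma is_lift_imp_continuous:
  assumes "is_lift f F"
  shows "continuous_on UNIV f"
proof -
  have "open (f -` U)" if "open U" for U
  proof -
    have "to_circle -` (f -` U) = F -` (to_circle -` U)"
      using assms by (auto simp: is_lift_def)
    moreover have "open (F -` (to_circle -` U))"
      using that assms open_vimage[of "to_circle -` U" F] by (simp add: open_circle_def is_lift_def)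
    ultimately show ?thesis by (simp add: open_circle_def)
  qed
  then show ?thesis by (simp add: continuous_on_open_vimage)
qed

lemma lift_map_descends:
  assumes F: "lift_map F"
  obtains f where "is_lift f F"
proof -
  have "is_lift (\<lambda>c. to_circle (F (rep_circle c))) F"
  proof -
    have "to_circle (F x) = to_circle (F (rep_circle (to_circle x)))" for x
    proof -
      have "to_circle (rep_circle (to_circle x)) = to_circle x"
        by (rule Quotient_abs_rep[OF Quotient_circle])
      then obtain k :: int where k: "rep_circle (to_circle x) = x + of_int k"
        by (metis Ints_cases add_diff_cancel_left' diff_add_cancel to_circle_eq_iff add.commute)
      show ?thesis unfolding k lift_map_add_int[OF F] by simp
    qed
    then show ?thesis using F by (simp add: is_lift_def lift_map_def)
  qed
  then show ?thesis by (rule that)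
qed

lemma lift_map_Homeo_plus:
  assumes F: "lift_map F" "is_lift f F"
  shows "f \<in> carrier Homeo_plus"
proof -
  obtain h where h: "is_lift h (inv_into UNIV F)" using lift_map_descends[OF lift_map_inv[OF F(1)]] by blast
  have "f (h c) = c" "h (f c) = c" for c
    using F(2) h lift_map_inv_cancel[OF F(1)] to_circle_surj[of c] unfolding is_lift_def by metis+
  then have "homeomorphism UNIV UNIV f h"
    using is_lift_imp_continuous[OF F(2)] is_lift_imp_continuous[OF h]
    by (auto intro!: homeomorphismI)
  then show ?thesis using F by (auto simp: Homeo_plus_def orientation_preserving_def lift_map_def)
qed

lemma Homeo_plus_inv_apply:
  assumes "f \<in> carrier Homeo_plus"
  shows "f ((inv\<^bsub>Homeo_plus\<^esub> f) c) = c" "(inv\<^bsub>Homeo_plus\<^esub> f) (f c) = c"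
proof -
  have "f \<otimes>\<^bsub>Homeo_plus\<^esub> inv\<^bsub>Homeo_plus\<^esub> f = \<one>\<^bsub>Homeo_plus\<^esub>"
    "inv\<^bsub>Homeo_plus\<^esub> f \<otimes>\<^bsub>Homeo_plus\<^esub> f = \<one>\<^bsub>Homeo_plus\<^esub>"
    using group.r_inv[OF group_Homeo_plus assms] group.l_inv[OF group_Homeo_plus assms] by auto
  then show "f ((inv\<^bsub>Homeo_plus\<^esub> f) c) = c" "(inv\<^bsub>Homeo_plus\<^esub> f) (f c) = c"
    by (auto simp: Homeo_plus_def fun_eq_iff)
qed

text \<open>\<open>Rot\<close> is a definite description over all lifts and base points, so the
  limit is needed for each of them: another lift is \<open>F\<close> plus an integer
  \<open>k\<close>, and \<open>\<alpha> + k\<close> is the same point of the circle.\<close>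

lemma Rot_eq:
  assumes F: "lift_map F" "is_lift f F"
    and disp: "\<And>n x. \<bar>(F ^^ n) x - x - real n * \<alpha>\<bar> \<le> c"
  shows "Rot f = to_circle \<alpha>"
proof -
  have lim: "(\<lambda>n. (F' ^^ n) t / real n) \<longlonglongrightarrow> \<alpha> + of_int k" if k: "\<And>x. F' x = F x + of_int k" for F' t k
  proof -
    have pow: "(F' ^^ n) t = (F ^^ n) t + real n * of_int k" for n
    proof (induction n)
      case (Suc n)
      have "(F' ^^ Suc n) t = F ((F ^^ n) t + of_int (int n * k)) + of_int k" by (simp add: k Suc)
      then show ?case unfolding lift_map_add_int[OF F(1)] by (simp add: algebra_simps)
    qed simp
    have "(\<lambda>n. (c + \<bar>t\<bar>) / real n) \<longlonglongrightarrow> 0" by (intro lim_const_over_n)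
    moreover have "\<forall>\<^sub>F n in sequentially. norm ((F' ^^ n) t / real n - (\<alpha> + of_int k)) \<le> (c + \<bar>t\<bar>) / real n"
    proof (rule eventually_sequentiallyI[of 1])
      fix n :: nat assume n: "1 \<le> n"
      have "(F' ^^ n) t / real n - (\<alpha> + of_int k) = ((F ^^ n) t - real n * \<alpha>) / real n"
        using n by (simp add: pow field_simps)
      moreover have "\<bar>(F ^^ n) t - real n * \<alpha>\<bar> \<le> c + \<bar>t\<bar>" using disp[of n t] by linarith
      ultimately show "norm ((F' ^^ n) t / real n - (\<alpha> + of_int k)) \<le> (c + \<bar>t\<bar>) / real n"
        by (simp add: divide_right_mono)
    qed
    ultimately have "(\<lambda>n. (F' ^^ n) t / real n - (\<alpha> + of_int k)) \<longlonglongrightarrow> 0" by (rule Lim_null_comparison[rotated])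
    then show ?thesis by (simp add: LIM_zero_iff)
  qed
  show ?thesis unfolding Rot_def
  proof (rule the_equality)
    show "\<forall>F t. is_lift f F \<longrightarrow> (\<exists>L. (\<lambda>n. (F ^^ n) t / real n) \<longlonglongrightarrow> L \<and> to_circle \<alpha> = to_circle L)"
    proof (intro allI impI)
      fix F' t assume "is_lift f F'"
      then obtain k where "\<And>x. F' x = F x + of_int k" using is_lift_unique[OF F(2)] by blast
      then show "\<exists>L. (\<lambda>n. (F' ^^ n) t / real n) \<longlonglongrightarrow> L \<and> to_circle \<alpha> = to_circle L"
        using lim[of F' k t] by (intro exI[of _ "\<alpha> + of_int k"]) simp
    qed
  next
    fix r assume "\<forall>F t. is_lift f F \<longrightarrow> (\<exists>L. (\<lambda>n. (F ^^ n) t / real n) \<longlonglongrightarrow> L \<and> r = to_circle L)"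
    then obtain L where "(\<lambda>n. (F ^^ n) 0 / real n) \<longlonglongrightarrow> L" "r = to_circle L" using F(2) by blast
    then show "r = to_circle \<alpha>" using lim[of F 0 0] LIMSEQ_unique by fastforce
  qed
qed

text \<open>Breakpoints are replaced by their representatives in \<open>[0,1)\<close>, where
  \<open>to_circle\<close> is injective, so finiteness is kept. Near other points some lift is
  affine, and \<open>F\<close> differs from it by a constant.\<close>

lemma piecewise_linear_bounded_distortion:
  assumes F: "lift_map F" "is_lift f F" and pl: "piecewise_linear f"
  shows "bounded_distortion F"
proof (rule bounded_distortion_PL[OF F(1)])
  let ?B = "to_circle -` breakpoints f \<inter> {0..<1}"
  have "inj_on to_circle {0..<1}"
  proof (rule inj_onI)
    fix x y :: real
    assume xy: "x \<in> {0..<1}" "y \<in> {0..<1}" "to_circle x = to_circle y"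
    then obtain k :: int where k: "x - y = of_int k" by (auto simp: to_circle_eq_iff elim: Ints_cases)
    then have "real_of_int k < 1" "-1 < real_of_int k" using xy by auto
    then have "k = 0" by linarith
    then show "x = y" using k by simp
  qed
  then show "finite ?B"
    using pl by (auto simp: piecewise_linear_def intro: finite_vimage_IntI)
  fix x :: real
  assume "frac x \<notin> ?B"
  then have "to_circle (frac x) \<notin> breakpoints f" using frac_lt_1[of x] by simp
  moreover have "to_circle (frac x) = to_circle x" by (simp add: to_circle_eq_iff frac_def)
  moreover have "to_circle x \<in> breakpoints f"
    if "\<not> (\<exists>F'. is_lift f F' \<and> (\<exists>p q. \<forall>\<^sub>F y in nhds x. F' y = p * y + q))"
    unfolding breakpoints_def using that by (intro imageI CollectI)
  ultimately obtain F' p q where F': "is_lift f F'" "\<forall>\<^sub>F y in nhds x. F' y = p * y + q"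
    by metis
  obtain k where "\<And>x. F x = F' x + of_int k" using is_lift_unique[OF F'(1) F(2)] by blast
  then have "\<forall>\<^sub>F y in nhds x. F y = p * y + (q + of_int k)"
    using F'(2) by (auto elim!: eventually_mono)
  then show "\<exists>p q. \<forall>\<^sub>F y in nhds x. F y = p * y + q" by blast
qed

text \<open>
  The derivative of a \<open>C\<^sup>1\<close> homeomorphism may vanish; differentiability of the inverse excludes this.
\<close>

lemma C1_bounded_distortion:
  assumes F: "lift_map F" "is_lift f F" and c1: "C1_bounded_variation f"
    and inv: "\<And>c. f (h c) = c" and c1_inv: "C1_bounded_variation h"
  shows "bounded_distortion F"
proof -
  obtain F1 F' where F1: "is_lift f F1" "\<And>x. (F1 has_real_derivative F' x) (at x)"
    "continuous_on UNIV F'" "bounded_variation_on F' 0 1"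
    using c1 unfolding C1_bounded_variation_def by blast
  obtain E E' where E: "is_lift h E" "\<And>x. (E has_real_derivative E' x) (at x)"
    using c1_inv unfolding C1_bounded_variation_def by blast
  obtain k where k: "\<And>x. F x = F1 x + of_int k" using is_lift_unique[OF F1(1) F(2)] by blast
  have der: "(F has_real_derivative F' x) (at x)" for x
  proof -
    have "((\<lambda>x. F1 x + of_int k) has_real_derivative F' x) (at x)"
      by (auto intro!: derivative_eq_intros F1(2))
    moreover have "F = (\<lambda>x. F1 x + of_int k)" using k by auto
    ultimately show ?thesis by simp
  qed
  have "is_lift id (F \<circ> E)"
    using is_lift_compose[OF F(2) E(1)] inv by (simp add: comp_def id_def)
  moreover have "is_lift id id" by (simp add: is_lift_def)
  ultimately obtain j where "\<And>x. (F \<circ> E) x = id x + of_int j" using is_lift_unique by blast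
  then have j: "(\<lambda>x. F (E x)) = (\<lambda>x. x + of_int j)" by auto
  \<comment> \<open>Chain rule for \<open>F o E\<close>, which is an integer translation as
    \<open>f o h\<close> is the identity. \<open>E\<close> takes every value, so \<open>F'\<close>
    vanishes nowhere.\<close>
  have nz: "F' (E x) * E' x = 1" for x
  proof -
    have "((\<lambda>x. F (E x)) has_real_derivative F' (E x) * E' x) (at x)"
      by (rule DERIV_chain2[OF der E(2)])
    moreover have "((\<lambda>x. F (E x)) has_real_derivative 1) (at x)"
      unfolding j by (auto intro!: derivative_eq_intros)
    ultimately show ?thesis by (rule DERIV_unique)
  qed
  have "F' x > 0" for x
  proof -
    have "F (E (F x)) = F x + of_int j" using j by meson
    also have "\<dots> = F (x + of_int j)" by (simp add: lift_map_add_int[OF F(1)])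
    finally have "E (F x) = x + of_int j" using lift_map_bij[OF F(1)] by (simp add: bij_is_inj inj_eq)
    moreover have "E (F x - of_int j) = x"
    proof -
      have "F (E (F x - of_int j)) = F x" using fun_cong[OF j, of "F x - of_int j"] by simp
      then show ?thesis using lift_map_bij[OF F(1)] by (simp add: bij_is_inj inj_eq)
    qed
    ultimately have "F' x \<noteq> 0" using nz[of "F x - of_int j"] by auto
    moreover have "F' x \<ge> 0"
    proof (rule ccontr)
      assume "\<not> 0 \<le> F' x"
      then obtain d where d: "d > 0" "\<And>h. 0 < h \<Longrightarrow> h < d \<Longrightarrow> F (x + h) < F x"
        using DERIV_neg_dec_right[OF der[of x]] by auto
      have "F (x + d / 2) < F x" using d by simp
      then show False using d(1) by (simp add: lift_map_less_iff[OF F(1)])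
    qed
    ultimately show ?thesis by simp
  qed
  then show ?thesis by (intro bounded_distortion_C1[OF F(1) der _ F1(3,4)])
qed

section \<open>Ping-pong\<close>

text \<open>\<open>X (f, True)\<close> and \<open>X (f, False)\<close> are the targets of
  \<open>f\<close> and of its inverse. A letter can only fail on the target of its inverse, and in a
  reduced word the tail never leads there.\<close>

lemma word_value_ping_pong:
  assumes S: "S \<subseteq> carrier H" and H: "group H" and act_mult: "\<And>f g. f \<in> carrier H \<Longrightarrow> g \<in> carrier H \<Longrightarrow> act (f \<otimes>\<^bsub>H\<^esub> g) = act f \<circ> act g"
    and act_one: "act \<one>\<^bsub>H\<^esub> = id"
    and base: "\<And>f e. f \<in> S \<Longrightarrow> x0 \<notin> X (f, e)"
    and disj: "\<And>l l'. fst l \<in> S \<Longrightarrow> fst l' \<in> S \<Longrightarrow> l \<noteq> l' \<Longrightarrow> X l \<inter> X l' = {}"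
    and move: "\<And>f c. f \<in> S \<Longrightarrow> c \<notin> X (f, False) \<Longrightarrow> act f c \<in> X (f, True)"
    and w: "w \<noteq> []" "set w \<subseteq> S \<times> UNIV" "reduced_word w"
  shows "word_value H w \<in> carrier H \<and> act (word_value H w) x0 \<in> X (hd w)"
proof -
  interpret group H by fact
  \<comment> \<open>\<open>move\<close> speaks of \<open>f\<close> only; for the inverse it is used
    in contraposition, as \<open>act f\<close> undoes the inverse.\<close>
  have letter: "act (if e then f else inv\<^bsub>H\<^esub> f) c \<in> X (f, e)" if f: "f \<in> S" and "c \<notin> X (f, \<not> e)" for f e c
  proof (cases e)
    case True
    then show ?thesis using move that by simp
  next
    case False
    have "act f (act (inv\<^bsub>H\<^esub> f) c) = c"
      using act_mult[of f "inv\<^bsub>H\<^esub> f"] S f act_one by (metis comp_apply id_apply inv_closed r_inv subsetD)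
    then show ?thesis using move[OF f, of "act (inv\<^bsub>H\<^esub> f) c"] that False by auto
  qed
  show ?thesis using w
  proof (induction w)
    case (Cons l w)
    obtain f e where l: "l = (f, e)" by (cases l)
    have f: "f \<in> S" using Cons.prems l by auto
    define u where "u = (if e then f else inv\<^bsub>H\<^esub> f)"
    have u: "u \<in> carrier H" using f S by (auto simp: u_def)
    have val: "word_value H (l # w) = u \<otimes>\<^bsub>H\<^esub> word_value H w"
      by (simp add: word_value_def l u_def)
    have "word_value H w \<in> carrier H \<and> act (word_value H w) x0 \<notin> X (f, \<not> e)"
    proof (cases w)
      case Nil
      then show ?thesis using base[OF f] act_one by (simp add: word_value_def)
    next
      case (Cons l' w')
      then have IH: "word_value H w \<in> carrier H" "act (word_value H w) x0 \<in> X l'"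
        using Cons.IH Cons.prems by (auto simp: reduced_word_def)
      have "l' \<noteq> (f, \<not> e)" "fst l' \<in> S"
        using Cons.prems Cons l by (auto simp: reduced_word_def)
      then show ?thesis using IH disj[of l' "(f, \<not> e)"] f by auto
    qed
    then show ?case using u letter[OF f] act_mult[OF u] unfolding val by (simp add: l u_def)
  qed simp
qed

text \<open>Four sets are the targets of \<open>a\<close>, \<open>b\<close> and their inverses; the
  fifth holds a base point outside all of them. \<open>a o b\<close> sends \<open>x0\<close> into
  \<open>U 1\<close> and \<open>b o a\<close> sends it into \<open>U 3\<close>, so \<open>a\<close>
  and \<open>b\<close> do not commute.\<close>

lemma ping_pong:
  fixes U :: "nat \<Rightarrow> circle set"
  assumes ab: "a \<in> carrier Homeo_plus" "b \<in> carrier Homeo_plus"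
    and disj: "\<And>i j. i \<le> 4 \<Longrightarrow> j \<le> 4 \<Longrightarrow> i \<noteq> j \<Longrightarrow> U i \<inter> U j = {}" and x0: "x0 \<in> U 4"
    and a: "\<And>c. c \<notin> U 0 \<Longrightarrow> a c \<in> U 1" and b: "\<And>c. c \<notin> U 2 \<Longrightarrow> b c \<in> U 3"
  defines "F \<equiv> generate Homeo_plus {a, b}"
  shows "subgroup F Homeo_plus \<and> free_group (Homeo_plus\<lparr>carrier := F\<rparr>) \<and>
    \<not> comm_group (Homeo_plus\<lparr>carrier := F\<rparr>)"
proof -
  interpret group Homeo_plus by (rule group_Homeo_plus)
  let ?H = "Homeo_plus\<lparr>carrier := F\<rparr>"
  have F: "subgroup F Homeo_plus" unfolding F_def using ab by (intro generate_is_subgroup) auto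
  have inF: "{a, b} \<subseteq> F" unfolding F_def by (auto intro: generate.incl)
  have H: "group ?H" by (rule subgroup_imp_group[OF F])
  have mult: "f \<otimes>\<^bsub>?H\<^esub> g = f \<circ> g" and one: "\<one>\<^bsub>?H\<^esub> = id" for f g
    by (simp_all add: Homeo_plus_def)
  have sep: "c \<notin> U i" if "c \<in> U j" "i \<noteq> j" "i \<le> 4" "j \<le> 4" for i j c
    using disj[OF that(3,4,2)] that(1) by blast
  have notin: "x0 \<notin> U i" if "i < 4" for i using sep[OF x0] that by simp
  have "a x0 \<in> U 1" "b x0 \<in> U 3" using a b notin by simp_all
  then have "a \<noteq> b" using sep[of "b x0" 3 1] by auto
  have "a (b x0) \<in> U 1" "b (a x0) \<in> U 3"
    using a b sep[OF \<open>b x0 \<in> U 3\<close>] sep[OF \<open>a x0 \<in> U 1\<close>] by simp_all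
  then have "a (b x0) \<noteq> b (a x0)" using sep[of "b (a x0)" 3 1] by auto
  then have "a \<circ> b \<noteq> b \<circ> a" by (metis comp_apply)
  then have "\<not> comm_group ?H"
    using inF comm_groupE(4)[of ?H a b] unfolding mult by auto
  moreover have "free_basis ?H {a, b}"
    unfolding free_basis_def
  proof (intro conjI allI impI)
    show "{a, b} \<subseteq> carrier ?H" using inF by simp
    show "generate ?H {a, b} = carrier ?H"
      using generate_consistent[OF inF F] by (simp add: F_def)
    fix w assume w: "w \<noteq> [] \<and> set w \<subseteq> {a, b} \<times> UNIV \<and> reduced_word w"
    \<comment> \<open>Letters \<open>a\<close> and \<open>b\<close> aim at \<open>U 1\<close> and
      \<open>U 3\<close>, their inverses at \<open>U 0\<close> and \<open>U 2\<close>.\<close>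
    define n where "n l = (if fst l = a then 0 else 2) + (if snd l then 1 else 0::nat)"
      for l :: "(circle \<Rightarrow> circle) \<times> bool"
    have n_less: "n l < 4" for l by (simp add: n_def)
    have "word_value ?H w \<in> carrier ?H \<and> (\<lambda>f. f) (word_value ?H w) x0 \<in> (\<lambda>l. U (n l)) (hd w)"
    proof (rule word_value_ping_pong[where S = "{a, b}" and H = ?H and act = "\<lambda>f. f"])
      show "U (n l) \<inter> U (n l') = {}" if "fst l \<in> {a, b}" "fst l' \<in> {a, b}" "l \<noteq> l'" for l l'
      proof (rule disj)
        show "n l \<noteq> n l'" using that \<open>a \<noteq> b\<close>
          by (cases l; cases l') (auto simp: n_def split: if_splits)
      qed (simp_all add: n_def)
      show "f c \<in> U (n (f, True))" if "f \<in> {a, b}" "c \<notin> U (n (f, False))" for f c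
        using that a b \<open>a \<noteq> b\<close> by (auto simp: n_def numeral_3_eq_3 numeral_2_eq_2)
    qed (use inF H mult one notin n_less w in auto)
    then have "word_value ?H w x0 \<noteq> x0" using notin n_less by metis
    then show "word_value ?H w \<noteq> \<one>\<^bsub>?H\<^esub>" unfolding one by auto
  qed
  ultimately show ?thesis using F H unfolding free_group_def by blast
qed

section \<open>Rotations or free subgroups\<close>

text \<open>The only use of the regularity assumption: it concerns \<open>g\<close> and, in the
  differentiable case, its inverse, which lies in \<open>G\<close> as well.\<close>

lemma linearization:
  assumes G: "subgroup G Homeo_plus"
    and reg: "(\<forall>f \<in> G. piecewise_linear f) \<or> (\<forall>f \<in> G. C1_bounded_variation f)"
    and g: "g \<in> G" "Rot g \<notin> rational_circle"
  obtains F \<alpha> Z where "lift_map F" "is_lift g F" "\<alpha> \<notin> \<rat>" "lift_map Z" "\<And>x. Z (F x) = Z x + \<alpha>"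
proof -
  have gH: "g \<in> carrier Homeo_plus" using G g subgroup.subset by blast
  obtain F where F: "lift_map F" "is_lift g F" using Homeo_plus_lift[OF gH] by blast
  obtain \<alpha> where disp: "\<And>n x. \<bar>(F ^^ n) x - x - real n * \<alpha>\<bar> \<le> 2"
    using lift_map_translation_number[OF F(1)] by blast
  have irr: "\<alpha> \<notin> \<rat>" using Rot_eq[OF F disp] g(2) by (auto simp: rational_circle_def)
  have "bounded_distortion F"
    using reg
  proof
    assume "\<forall>f \<in> G. piecewise_linear f"
    then show ?thesis using piecewise_linear_bounded_distortion[OF F] g(1) by blast
  next
    assume c1: "\<forall>f \<in> G. C1_bounded_variation f"
    have "inv\<^bsub>Homeo_plus\<^esub> g \<in> G" using subgroup.m_inv_closed[OF G g(1)] .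
    then show ?thesis
      using C1_bounded_distortion[OF F _ Homeo_plus_inv_apply(1)[OF gH]] c1 g(1) by blast
  qed
  then obtain V C where V: "mono V" "\<And>x. V (x + 1) = V x + C"
    and dist: "\<And>a b x y x' y'. a \<le> x \<and> x < y \<and> y \<le> b \<and> a \<le> x' \<and> x' < y' \<and> y' \<le> b \<and> b \<le> a + 1 \<Longrightarrow>
       \<bar>ln ((F y - F x) / (y - x)) - ln ((F y' - F x') / (y' - x'))\<bar> \<le> V b - V a"
    unfolding bounded_distortion_def by blast
  obtain Z where "lift_map Z" "\<And>x. Z (F x) = Z x + \<alpha>"
    using Denjoy[OF F(1) irr disp V dist] by blast
  then show ?thesis using that F irr by blast
qed

lemma conjugate_to_rotationsI:
  assumes G: "subgroup G Homeo_plus" and Z: "lift_map Z"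
    and rot: "\<And>f. f \<in> G \<Longrightarrow> \<exists>F c. is_lift f F \<and> (\<forall>x. Z (F x) = Z x + c)"
  shows "conjugate_to_rotations G \<and> comm_group (Homeo_plus\<lparr>carrier := G\<rparr>)"
proof -
  obtain z where z: "is_lift z Z" using lift_map_descends[OF Z] by blast
  have zH: "z \<in> carrier Homeo_plus" by (rule lift_map_Homeo_plus[OF Z z])
  then obtain z' where "homeomorphism UNIV UNIV z z'" by (auto simp: Homeo_plus_def)
  then have bij: "bij z" by (metis UNIV_I bijI' homeomorphism_def)
  have rot': "\<exists>\<gamma>. \<forall>c. z (f c) = z c + \<gamma>" if f: "f \<in> G" for f
  proof -
    obtain F \<beta> where F: "is_lift f F" "\<And>x. Z (F x) = Z x + \<beta>" using rot[OF f] by blast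
    have "z (f c) = z c + to_circle \<beta>" for c
    proof -
      obtain x where x: "c = to_circle x" using to_circle_surj by blast
      have "z (f c) = to_circle (Z (F x))" using F(1) z by (simp add: is_lift_def x)
      also have "\<dots> = z c + to_circle \<beta>" using z by (simp add: is_lift_def x F(2) to_circle_plus)
      finally show ?thesis .
    qed
    then show ?thesis by blast
  qed
  have "conjugate_to_rotations G" unfolding conjugate_to_rotations_def
  proof (intro bexI[OF _ zH] ballI)
    fix f assume "f \<in> G"
    then obtain \<gamma> where "\<And>c. z (f c) = z c + \<gamma>" using rot' by blast
    then have "z \<circ> f \<circ> inv_into UNIV z = (\<lambda>c. c + \<gamma>)"
      using bij by (auto simp: fun_eq_iff bij_is_surj surj_f_inv_f)
    then show "\<exists>\<gamma>. z \<circ> f \<circ> inv_into UNIV z = (\<lambda>c. c + \<gamma>)" by blast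
  qed
  moreover have "comm_group (Homeo_plus\<lparr>carrier := G\<rparr>)"
  proof (rule group.group_comm_groupI)
    show "group (Homeo_plus\<lparr>carrier := G\<rparr>)" by (rule group.subgroup_imp_group[OF group_Homeo_plus G])
    fix f h assume "f \<in> carrier (Homeo_plus\<lparr>carrier := G\<rparr>)" "h \<in> carrier (Homeo_plus\<lparr>carrier := G\<rparr>)"
    then have "f \<in> G" "h \<in> G" by simp_all
    then obtain \<gamma> \<delta> where "\<And>c. z (f c) = z c + \<gamma>" "\<And>c. z (h c) = z c + \<delta>"
      using rot' by meson
    then have "z (f (h c)) = z (h (f c))" for c by (simp add: algebra_simps)
    then have "f \<circ> h = h \<circ> f" using bij by (auto simp: fun_eq_iff bij_is_inj inj_eq)
    then show "f \<otimes>\<^bsub>Homeo_plus\<lparr>carrier := G\<rparr>\<^esub> h = h \<otimes>\<^bsub>Homeo_plus\<lparr>carrier := G\<rparr>\<^esub> f"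
      by (simp add: Homeo_plus_def)
  qed
  ultimately show ?thesis by blast
qed

text \<open>Conjugation by \<open>Z\<close> turns lifts of powers of \<open>g\<close> into a dense
  set of translations and \<open>F1\<close> into a map \<open>H\<close> whose displacement is not
  constant. This feeds \<open>exists_hyperbolic\<close> twice, on four of five arcs of
  \<open>\<real>/p\<int>\<close>.\<close>

lemma free_subgroup_of_non_rotation:
  assumes G: "subgroup G Homeo_plus"
    and g: "g \<in> G" "lift_map F0" "is_lift g F0" and irr: "\<alpha> \<notin> \<rat>"
    and Z: "lift_map Z" "\<And>x. Z (F0 x) = Z x + \<alpha>"
    and f: "f \<in> G" "lift_map F1" "is_lift f F1" and nonrot: "\<And>c. \<exists>x. Z (F1 x) \<noteq> Z x + c"
  shows "\<exists>F. F \<subseteq> G \<and> subgroup F Homeo_plus \<and> free_group (Homeo_plus\<lparr>carrier := F\<rparr>) \<and>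
         \<not> comm_group (Homeo_plus\<lparr>carrier := F\<rparr>)"
proof -
  let ?Z' = "inv_into UNIV Z"
  note Zc [simp] = lift_map_inv_cancel[OF Z(1)]
  have Z': "lift_map ?Z'" by (rule lift_map_inv[OF Z(1)])
  define H where "H x = Z (F1 (?Z' x))" for x
  have H: "lift_map H" unfolding H_def
    by (rule lift_map_comp[OF Z(1) lift_map_comp[OF f(2) Z']])
  have "\<exists>u v. H u - u \<noteq> H v - v"
  proof (rule ccontr)
    assume "\<not> ?thesis"
    then have const: "H u - u = H 0 - 0" for u by metis
    have "Z (F1 x) = Z x + H 0" for x
    proof -
      have "H (Z x) = Z (F1 x)" by (simp add: H_def)
      then show ?thesis using const[of "Z x"] by linarith
    qed
    then show False using nonrot by metis
  qed
  then obtain u v where uv: "H u - u \<noteq> H v - v" by blast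
  have "continuous_on UNIV (\<lambda>x. H x - x)" using H by (auto simp: lift_map_def intro!: continuous_intros)
  moreover have "H (x + 1) - (x + 1) = H x - x" for x using H by (simp add: lift_map_def)
  ultimately obtain p k where p: "p > 0" "\<And>x. H (x + p) - (x + p) = H x - x" "1 = of_int k * p"
    "\<And>s. 0 < s \<Longrightarrow> s < p \<Longrightarrow> \<exists>x. H (x + s) - (x + s) \<noteq> H x - x"
    using minimal_period[of "\<lambda>x. H x - x" u v] uv by blast
  \<comment> \<open>Conjugated lifts of elements of \<open>G\<close>, restricted to those that
    descend to \<open>\<real>/p\<int>\<close>. An arbitrary element of \<open>G\<close> need not do
    so, but \<open>H\<close> and the translations do.\<close>
  define N where "N = {K. \<exists>f\<in>G. \<exists>F. lift_map F \<and> is_lift f F \<and> (\<forall>x. K x = Z (F (?Z' x))) \<and>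
    (\<forall>x. K (x + p) = K x + p)}"
  have comp: "(\<lambda>x. K1 (K2 x)) \<in> N" if K: "K1 \<in> N" "K2 \<in> N" for K1 K2
  proof -
    obtain f1 F1 f2 F2 where 1: "f1 \<in> G" "lift_map F1" "is_lift f1 F1" "\<And>x. K1 x = Z (F1 (?Z' x))"
      and 2: "f2 \<in> G" "lift_map F2" "is_lift f2 F2" "\<And>x. K2 x = Z (F2 (?Z' x))"
      and c: "\<And>x. K1 (x + p) = K1 x + p" "\<And>x. K2 (x + p) = K2 x + p"
      using K unfolding N_def by blast
    have "f1 \<circ> f2 \<in> G" using subgroup.m_closed[OF G 1(1) 2(1)] by (simp add: Homeo_plus_def)
    moreover have "lift_map (F1 \<circ> F2)" using lift_map_comp[OF 1(2) 2(2)] by (simp add: comp_def)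
    moreover have "is_lift (f1 \<circ> f2) (F1 \<circ> F2)" by (rule is_lift_compose[OF 1(3) 2(3)])
    moreover have "K1 (K2 x) = Z ((F1 \<circ> F2) (?Z' x))" for x by (simp add: 1(4) 2(4))
    moreover have "K1 (K2 (x + p)) = K1 (K2 x) + p" for x by (simp add: c)
    ultimately show ?thesis unfolding N_def by blast
  qed
  have mono: "strict_mono K" if K: "K \<in> N" for K
  proof -
    obtain F where F: "lift_map F" "\<And>x. K x = Z (F (?Z' x))" using K unfolding N_def by blast
    then have "K = (\<lambda>x. Z (F (?Z' x)))" by auto
    moreover have "lift_map (\<lambda>x. Z (F (?Z' x)))"
      by (rule lift_map_comp[OF Z(1) lift_map_comp[OF F(1) Z']])
    ultimately show ?thesis by (simp add: lift_map_def)
  qed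
  have pow: "g ^^ n \<in> G \<and> is_lift (g ^^ n) (F0 ^^ n) \<and> (\<forall>x. Z ((F0 ^^ n) x) = Z x + real n * \<alpha>)" for n
  proof (induction n)
    case 0
    then show ?case using subgroup.one_closed[OF G] by (simp add: Homeo_plus_def is_lift_def id_def)
  next
    case (Suc n)
    then have "g \<circ> g ^^ n \<in> G" using subgroup.m_closed[OF G g(1)] by (simp add: Homeo_plus_def)
    moreover have "is_lift (g \<circ> g ^^ n) (F0 \<circ> F0 ^^ n)" using Suc is_lift_compose[OF g(3)] by blast
    moreover have "Z ((F0 \<circ> F0 ^^ n) x) = Z x + real (Suc n) * \<alpha>" for x
      using Suc by (simp add: Z(2) algebra_simps)
    ultimately show ?case unfolding funpow.simps by blast
  qed
  have trans: "\<exists>t. a < t \<and> t < b \<and> (\<lambda>x. x + t) \<in> N" if ab: "a < b" for a b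
  proof -
    obtain n :: nat and m :: int where nm: "a < real n * \<alpha> + of_int m" "real n * \<alpha> + of_int m < b"
      using dense_multiples_mod_int[OF irr ab] by blast
    \<comment> \<open>Adding the integer \<open>m\<close> changes only the lift, not the element of
      \<open>G\<close>.\<close>
    have "is_lift (g ^^ n) (\<lambda>x. (F0 ^^ n) x + of_int m)"
      using pow[of n] by (auto simp: is_lift_def intro!: continuous_intros)
    moreover have "lift_map (\<lambda>x. (F0 ^^ n) x + of_int m)"
      using lift_map_comp[OF lift_map_translation lift_map_funpow[OF g(2)]] .
    moreover have "x + (real n * \<alpha> + of_int m) = Z ((F0 ^^ n) (?Z' x) + of_int m)" for x
      using pow[of n] by (simp add: lift_map_add_int[OF Z(1)])
    moreover have "x + p + (real n * \<alpha> + of_int m) = x + (real n * \<alpha> + of_int m) + p" for x by simp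
    ultimately have "(\<lambda>x. x + (real n * \<alpha> + of_int m)) \<in> N"
      unfolding N_def using pow[of n] by blast
    then show ?thesis using nm by blast
  qed
  have "H \<in> N"
  proof -
    have "H (x + p) = H x + p" for x using p(2)[of x] by linarith
    then show ?thesis unfolding N_def H_def using f by blast
  qed
  have no_period: "\<exists>x. H (x + s) \<noteq> H x + s" if "0 < s" "s < p" for s
    using p(4)[OF that] by (auto simp: algebra_simps)
  have per: "K (x + p) = K x + p" if "K \<in> N" for K x using that unfolding N_def by blast
  have contH: "continuous_on UNIV H" using H by (simp add: lift_map_def)
  \<comment> \<open>Five open arcs of length \<open>2 * r\<close> fit exactly into
    \<open>\<real>/p\<int>\<close>.\<close>
  define r where "r = p / 10"
  \<comment> \<open>The points whose \<open>Z\<close>-coordinate modulo \<open>p\<close> lies in the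
    \<open>i\<close>-th arc. As \<open>1 = of_int k * p\<close>, this does not depend on the
    representative \<open>y\<close>.\<close>
  define U where "U i = {to_circle y | y. \<exists>k::int. real i * (2 * r) < Z y + of_int k * p \<and>
    Z y + of_int k * p < real i * (2 * r) + 2 * r}" for i :: nat
  have hyp: "\<exists>a\<in>G. \<forall>c. c \<notin> U i \<longrightarrow> a c \<in> U j" for i j
  proof -
    obtain K where K: "K \<in> N" and out: "\<And>y. \<lbrakk>\<And>k::int. \<not> (real i * (2 * r) < y + of_int k * p \<and> y + of_int k * p < real i * (2 * r) + 2 * r)\<rbrakk> \<Longrightarrow>
      \<exists>k::int. real j * (2 * r) < K y + of_int k * p \<and> K y + of_int k * p < real j * (2 * r) + 2 * r"
      using exists_hyperbolic[where N = N and p = p and H = H and r = r and c = "real i * (2 * r)" and d = "real j * (2 * r)"]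
        comp mono per trans \<open>H \<in> N\<close> contH no_period p(1) by (auto simp: r_def)
    obtain a F where a: "a \<in> G" "is_lift a F" "\<And>x. K x = Z (F (?Z' x))" using K unfolding N_def by blast
    have "a c \<in> U j" if "c \<notin> U i" for c
    proof -
      obtain y where y: "c = to_circle y" using to_circle_surj by blast
      have "\<not> (real i * (2 * r) < Z y + of_int k * p \<and> Z y + of_int k * p < real i * (2 * r) + 2 * r)" for k :: int
        using that y unfolding U_def by blast
      then obtain k :: int where "real j * (2 * r) < K (Z y) + of_int k * p \<and> K (Z y) + of_int k * p < real j * (2 * r) + 2 * r"
        using out by blast
      then have "to_circle (F y) \<in> U j" unfolding U_def a(3) by auto
      then show ?thesis using a(2) by (simp add: y is_lift_def)
    qed
    then show ?thesis using a(1) by blast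
  qed
  obtain a b where ab: "a \<in> G" "\<And>c. c \<notin> U 0 \<Longrightarrow> a c \<in> U 1" "b \<in> G" "\<And>c. c \<notin> U 2 \<Longrightarrow> b c \<in> U 3"
    using hyp[of 0 1] hyp[of 2 3] by blast
  have disj: "U i \<inter> U j = {}" if ij: "i \<le> 4" "j \<le> 4" "i \<noteq> j" for i j
  proof (rule ccontr)
    assume "U i \<inter> U j \<noteq> {}"
    then obtain y y' and k1 k2 :: int where y: "to_circle y = to_circle y'"
      and 1: "real i * (2 * r) < Z y + of_int k1 * p" "Z y + of_int k1 * p < real i * (2 * r) + 2 * r"
      and 2: "real j * (2 * r) < Z y' + of_int k2 * p" "Z y' + of_int k2 * p < real j * (2 * r) + 2 * r"
      unfolding U_def by blast
    obtain m :: int where "y = y' + of_int m"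
      using y by (metis Ints_cases add_diff_cancel_left' diff_add_cancel to_circle_eq_iff add.commute)
    then have "Z y = Z y' + of_int m * (of_int k * p)"
      using lift_map_add_int[OF Z(1)] p(3) by simp
    then have eq: "Z y + of_int k1 * p = (Z y' + of_int k2 * p) + of_int (m * k + k1 - k2) * p"
      by (simp add: algebra_simps)
    \<comment> \<open>All five arcs lie in \<open>(0, p)\<close>, so points of two of them that
      agree modulo \<open>p\<close> are equal, and then the arcs coincide.\<close>
    define l where "l = m * k + k1 - k2"
    have rp: "2 * r * 5 = p" by (simp add: r_def)
    have "real i * (2 * r) \<le> 4 * (2 * r)" "real j * (2 * r) \<le> 4 * (2 * r)"
      using ij p(1) by (auto simp: r_def intro!: mult_right_mono)
    moreover have "0 \<le> real i * (2 * r)" "0 \<le> real j * (2 * r)" using p(1) by (simp_all add: r_def)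
    ultimately have "of_int l * p < 1 * p" "-1 * p < of_int l * p"
      using 1 2 eq rp unfolding l_def by linarith+
    then have "real_of_int l < 1" "-1 < real_of_int l"
      using mult_right_less_imp_less[OF _ less_imp_le[OF p(1)]] by blast+
    then have "l = 0" by linarith
    then have "Z y + of_int k1 * p = Z y' + of_int k2 * p" using eq unfolding l_def[symmetric] by simp
    then have "real i * (2 * r) < (real j + 1) * (2 * r)" "real j * (2 * r) < (real i + 1) * (2 * r)"
      using 1 2 by (simp_all add: algebra_simps)
    moreover have "0 \<le> 2 * r" using p(1) by (simp add: r_def)
    ultimately have "real i < real j + 1" "real j < real i + 1"
      by (blast dest: mult_right_less_imp_less)+
    then show False using ij by linarith
  qed
  \<comment> \<open>\<open>9 * r\<close> is the midpoint of the last arc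
    \<open>(8 * r, 10 * r)\<close>.\<close>
  have x0: "to_circle (?Z' (9 * r)) \<in> U 4"
    unfolding U_def using p(1) by (auto simp: r_def intro!: exI[of _ "?Z' (9 * r)"] exI[of _ "0::int"])
  have sub: "generate Homeo_plus {a, b} \<subseteq> G"
    using group.generate_subgroup_incl[OF group_Homeo_plus _ G] ab by simp
  have abH: "a \<in> carrier Homeo_plus" "b \<in> carrier Homeo_plus"
    using ab(1,3) subgroup.subset[OF G] by auto
  show ?thesis
    by (intro exI[of _ "generate Homeo_plus {a, b}"] conjI[OF sub] ping_pong[OF abH disj x0 ab(2,4)])
qed

theorem theorem1p11:
  fixes G :: "(circle \<Rightarrow> circle) set"
  assumes "subgroup G Homeo_plus"
    and "(\<forall>f \<in> G. piecewise_linear f) \<or> (\<forall>f \<in> G. C1_bounded_variation f)"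
    and "\<exists>g \<in> G. Rot g \<notin> rational_circle"
  shows "(conjugate_to_rotations G \<and> comm_group (Homeo_plus\<lparr>carrier := G\<rparr>)) \<or>
    (\<exists>F. F \<subseteq> G \<and> subgroup F Homeo_plus \<and> free_group (Homeo_plus\<lparr>carrier := F\<rparr>) \<and>
         \<not> comm_group (Homeo_plus\<lparr>carrier := F\<rparr>))"
proof -
  obtain g where g: "g \<in> G" "Rot g \<notin> rational_circle" using assms(3) by blast
  obtain F0 \<alpha> Z where F0: "lift_map F0" "is_lift g F0" "\<alpha> \<notin> \<rat>"
    and Z: "lift_map Z" "\<And>x. Z (F0 x) = Z x + \<alpha>"
    using linearization[OF assms(1,2) g] by blast
  show ?thesis
  proof (cases "\<forall>f\<in>G. \<exists>F c. is_lift f F \<and> (\<forall>x. Z (F x) = Z x + c)")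
    case True
    then show ?thesis using conjugate_to_rotationsI[OF assms(1) Z(1)] by blast
  next
    case False
    then obtain f where f: "f \<in> G" "\<And>F c. is_lift f F \<Longrightarrow> \<exists>x. Z (F x) \<noteq> Z x + c" by blast
    obtain F1 where F1: "lift_map F1" "is_lift f F1"
      using Homeo_plus_lift f(1) subgroup.subset[OF assms(1)] by blast
    show ?thesis
      using free_subgroup_of_non_rotation[OF assms(1) g(1) F0(1,2,3) Z f(1) F1 f(2)[OF F1(2)]] by blast
  qed
qed

end
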